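(* Let $\mathcal{N}$ be a nonempty subset of $\mathcal{X}$ and let $\mathbf{g}:\mathbb{R}^{m_0+m}\to\mathbb{R}^{m_0+m}$ be mixed symmetric (with respect to $\mathcal{P}$) on $\kappa_{\mathcal{N}}=\{\kappa(X)\mid X\in\mathcal{N}\}$. Then the spectral operator $G:\mathcal{N}\to\mathcal{X}$ with respect to $\mathbf{g}$ is well-defined; that is, for every $X=(X_1,\ldots,X_s)\in\mathcal{N}$ the value $G(X)=(G_1(X),\ldots,G_s(X))$ given by $$G_k(X)=\begin{cases}P_k\,\mathrm{Diag}\big(\mathbf{g}_k(\kappa(X))\big)P_k^{*}, & 1\le k\le s_0,\\ U_k\,[\mathrm{Diag}\big(\mathbf{g}_k(\kappa(X))\big)\quad 0]\,V_k^{*}, & s_0+1\le k\le s,\end{cases}$$ does not depend on the choice of $P_k\in\mathbb{O}^{m_k}(X_k)$ ($1\le k\le s_0$) and of $(U_k,V_k)\in\mathbb{O}^{m_k,n_k}(X_k)$ ($s_0+1\le k\le s$).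
   Context: Fix the field to be $\mathbb{R}$ or $\mathbb{C}$. $\mathbb{V}^{p\times q}$ denotes $\mathbb{R}^{p\times q}$ or $\mathbb{C}^{p\times q}$ accordingly (viewed as a real vector space), $X^{*}$ is the (conjugate) transpose, $\mathbb{S}^p\subseteq\mathbb{V}^{p\times p}$ is the real vector space of real symmetric (resp. complex Hermitian) matrices, and $\mathbb{O}^p$ is the set of $p\times p$ orthogonal (resp. unitary) matrices. For $Y\in\mathbb{S}^p$, $\lambda(Y)$ is the vector of eigenvalues $\lambda_1(Y)\ge\cdots\ge\lambda_p(Y)$, counted with multiplicity. For $Z\in\mathbb{V}^{p\times q}$ with $p\le q$, $\sigma(Z)\in\mathbb{R}^p$ is the vector of singular values $\sigma_1(Z)\ge\cdots\ge\sigma_p(Z)\ge 0$. $\mathrm{Diag}(x)$ is the diagonal matrix with diagonal $x$. $\mathbb{O}^p(Y)$ is the set of $P\in\mathbb{O}^p$ with $Y=P\,\mathrm{Diag}(\lambda(Y))P^{*}$, and $\mathbb{O}^{p,q}(Z)$ is the set of pairs $(U,V)\in\mathbb{O}^p\times\mathbb{O}^q$ with $Z=U[\mathrm{Diag}(\sigma(Z))\quad 0]V^{*}$. Let $s\ge 1$ and $0\le s_0\le s$ be integers, let $m_1,\ldots,m_s$ and $n_{s_0+1},\ldots,n_s$ be positive integers with $m_k\le n_k$ for $k=s_0+1,\ldots,s$, and set $$\mathcal{X}:=\mathbb{S}^{m_1}\times\cdots\times\mathbb{S}^{m_{s_0}}\times\mathbb{V}^{m_{s_0+1}\times n_{s_0+1}}\times\cdots\times\mathbb{V}^{m_s\times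 n_s},$$ $m_0:=\sum_{k=1}^{s_0}m_k$, $m:=\sum_{k=s_0+1}^{s}m_k$. For $X=(X_1,\ldots,X_s)\in\mathcal{X}$ let $\kappa(X):=(\lambda(X_1),\ldots,\lambda(X_{s_0}),\sigma(X_{s_0+1}),\ldots,\sigma(X_s))\in\mathbb{R}^{m_0+m}$. $\mathbb{P}^p$ is the set of $p\times p$ permutation matrices and $\pm\mathbb{P}^p$ the set of signed permutation matrices (exactly one nonzero entry in each row and each column, that entry being $\pm1$). Let $\mathcal{P}:=\{(Q_1,\ldots,Q_s)\mid Q_k\in\mathbb{P}^{m_k},\ 1\le k\le s_0,\ Q_k\in\pm\mathbb{P}^{m_k},\ s_0+1\le k\le s\}$. Write $\mathbf{x}=(\mathbf{x}_1,\ldots,\mathbf{x}_s)\in\mathbb{R}^{m_0+m}$ and $\mathbf{g}(\mathbf{x})=(\mathbf{g}_1(\mathbf{x}),\ldots,\mathbf{g}_s(\mathbf{x}))$ with $\mathbf{x}_k,\mathbf{g}_k(\mathbf{x})\in\mathbb{R}^{m_k}$. The mapping $\mathbf{g}$ is mixed symmetric (with respect to $\mathcal{P}$) at $\mathbf{x}$ if $\mathbf{g}(Q_1\mathbf{x}_1,\ldots,Q_s\mathbf{x}_s)=(Q_1\mathbf{g}_1(\mathbf{x}),\ldots,Q_s\mathbf{g}_s(\mathbf{x}))$ for all $(Q_1,\ldots,Q_s)\in\mathcal{P}$, and mixed symmetric on a set if this holds at every point of the set. *)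

theory Defs
  imports "Jordan_Normal_Form.Schur_Decomposition" "HOL-Library.Multiset" "HOL-Library.FuncSet"
begin

text \<open>
  The definitions below are polymorphic in the scalar type and are meant for
  \<^typ>\<open>real\<close> and \<^typ>\<open>complex\<close>, where \<^const>\<open>mat_adjoint\<close> is the transpose and the
  conjugate transpose, respectively. Entries of matrices and vectors are indexed from 0,
  blocks of a tuple are indexed from 1.
\<close>

definition hermitian_mats :: "nat \<Rightarrow> 'a :: conjugatable_field mat set" where
  "hermitian_mats p = {Y \<in> carrier_mat p p. mat_adjoint Y = Y}"

definition unitary_mats :: "nat \<Rightarrow> 'a :: conjugatable_field mat set" where
  "unitary_mats p = {P \<in> carrier_mat p p. P * mat_adjoint P = 1\<^sub>m p \<and> mat_adjoint P * P = 1\<^sub>m p}"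

text \<open>
  Real eigenvalues with algebraic multiplicity. For a Hermitian matrix these are all
  the eigenvalues.
\<close>

definition eigval_mset :: "'a :: {conjugatable_field, real_field} mat \<Rightarrow> real multiset" where
  "eigval_mset Y =
     (\<Sum>x | eigenvalue Y (of_real x). replicate_mset (order (of_real x) (char_poly Y)) x)"

definition eigval_vec :: "'a :: {conjugatable_field, real_field} mat \<Rightarrow> real vec" where
  "eigval_vec Y = vec_of_list (rev (sorted_list_of_multiset (eigval_mset Y)))"

text \<open>For a \<open>p \<times> q\<close> matrix with \<open>p \<le> q\<close>.\<close>

definition singval_vec :: "'a :: {conjugatable_field, real_field} mat \<Rightarrow> real vec" where
  "singval_vec Z = map_vec sqrt (eigval_vec (Z * mat_adjoint Z))"

definition Diag :: "real vec \<Rightarrow> 'a :: real_field mat" where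
  "Diag x = mat_diag (dim_vec x) (\<lambda>i. of_real (x $ i))"

text \<open>The matrix \<open>[Diag(x) 0]\<close> with \<open>q\<close> columns, where \<open>dim_vec x \<le> q\<close>.\<close>

definition Diag_pad :: "nat \<Rightarrow> real vec \<Rightarrow> 'a :: real_field mat" where
  "Diag_pad q x = mat (dim_vec x) q (\<lambda>(i, j). if i = j then of_real (x $ i) else 0)"

definition eig_bases :: "'a :: {conjugatable_field, real_field} mat \<Rightarrow> 'a mat set" where
  "eig_bases Y = {P \<in> unitary_mats (dim_row Y). Y = P * Diag (eigval_vec Y) * mat_adjoint P}"

definition sing_bases :: "'a :: {conjugatable_field, real_field} mat \<Rightarrow> ('a mat \<times> 'a mat) set" where
  "sing_bases Z = {(U, V). U \<in> unitary_mats (dim_row Z) \<and> V \<in> unitary_mats (dim_col Z) \<and>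
     Z = U * Diag_pad (dim_col Z) (singval_vec Z) * mat_adjoint V}"

text \<open>
  The product space: an element is a function on the block indices \<open>1, \<dots>, s\<close>,
  undefined elsewhere.
\<close>

definition mat_space ::
  "nat \<Rightarrow> nat \<Rightarrow> (nat \<Rightarrow> nat) \<Rightarrow> (nat \<Rightarrow> nat) \<Rightarrow> (nat \<Rightarrow> 'a :: conjugatable_field mat) set" where
  "mat_space s s0 m n =
     (\<Pi>\<^sub>E k\<in>{1..s}. if k \<le> s0 then hermitian_mats (m k) else carrier_mat (m k) (n k))"

text \<open>Splitting a vector into consecutive blocks of lengths \<open>m 1, m 2, \<dots>\<close>, and joining blocks.\<close>

definition vec_block :: "(nat \<Rightarrow> nat) \<Rightarrow> nat \<Rightarrow> real vec \<Rightarrow> real vec" where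
  "vec_block m k x = vec (m k) (\<lambda>i. x $ (sum m {1..<k} + i))"

definition vec_join :: "nat \<Rightarrow> (nat \<Rightarrow> real vec) \<Rightarrow> real vec" where
  "vec_join s f = vec_of_list (concat (map (\<lambda>k. list_of_vec (f k)) [1..<Suc s]))"

definition kappa :: "nat \<Rightarrow> nat \<Rightarrow> (nat \<Rightarrow> 'a :: {conjugatable_field, real_field} mat) \<Rightarrow> real vec" where
  "kappa s s0 X = vec_join s (\<lambda>k. if k \<le> s0 then eigval_vec (X k) else singval_vec (X k))"

definition signed_perm_mats :: "nat \<Rightarrow> real mat set" where
  "signed_perm_mats p = {Q \<in> carrier_mat p p.
     (\<forall>i<p. \<exists>!j. j < p \<and> Q $$ (i, j) \<noteq> 0) \<and>
     (\<forall>j<p. \<exists>!i. i < p \<and> Q $$ (i, j) \<noteq> 0) \<and>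
     (\<forall>i<p. \<forall>j<p. Q $$ (i, j) \<in> {-1, 0, 1})}"

definition perm_mats :: "nat \<Rightarrow> real mat set" where
  "perm_mats p = {Q \<in> signed_perm_mats p. \<forall>i<p. \<forall>j<p. Q $$ (i, j) \<in> {0, 1}}"

definition mixed_perms :: "nat \<Rightarrow> nat \<Rightarrow> (nat \<Rightarrow> nat) \<Rightarrow> (nat \<Rightarrow> real mat) set" where
  "mixed_perms s s0 m =
     (\<Pi> k\<in>{1..s}. if k \<le> s0 then perm_mats (m k) else signed_perm_mats (m k))"

definition mixed_symmetric_on ::
  "nat \<Rightarrow> nat \<Rightarrow> (nat \<Rightarrow> nat) \<Rightarrow> (real vec \<Rightarrow> real vec) \<Rightarrow> real vec set \<Rightarrow> bool" where
  "mixed_symmetric_on s s0 m g S \<longleftrightarrow> (\<forall>x\<in>S. \<forall>Q\<in>mixed_perms s s0 m.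
     g (vec_join s (\<lambda>k. Q k *\<^sub>v vec_block m k x)) =
     vec_join s (\<lambda>k. Q k *\<^sub>v vec_block m k (g x)))"

definition spectral_choices ::
  "nat \<Rightarrow> nat \<Rightarrow> (nat \<Rightarrow> 'a :: {conjugatable_field, real_field} mat) \<Rightarrow>
    ((nat \<Rightarrow> 'a mat) \<times> (nat \<Rightarrow> 'a mat) \<times> (nat \<Rightarrow> 'a mat)) set" where
  "spectral_choices s s0 X = {(P, U, V).
     (\<forall>k\<in>{1..s0}. P k \<in> eig_bases (X k)) \<and>
     (\<forall>k\<in>{s0+1..s}. (U k, V k) \<in> sing_bases (X k))}"

text \<open>The value \<open>G(X)\<close> computed from one particular choice of the matrices \<open>P, U, V\<close>.\<close>

definition spectral_value ::
  "nat \<Rightarrow> nat \<Rightarrow> (nat \<Rightarrow> nat) \<Rightarrow> (nat \<Rightarrow> nat) \<Rightarrow> (real vec \<Rightarrow> real vec) \<Rightarrow>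
    (nat \<Rightarrow> 'a :: {conjugatable_field, real_field} mat) \<Rightarrow>
    (nat \<Rightarrow> 'a mat) \<times> (nat \<Rightarrow> 'a mat) \<times> (nat \<Rightarrow> 'a mat) \<Rightarrow> nat \<Rightarrow> 'a mat" where
  "spectral_value s s0 m n g X = (\<lambda>(P, U, V). \<lambda>k\<in>{1..s}.
     if k \<le> s0 then P k * Diag (vec_block m k (g (kappa s s0 X))) * mat_adjoint (P k)
     else U k * Diag_pad (n k) (vec_block m k (g (kappa s s0 X))) * mat_adjoint (V k))"

end

theory Submission
  imports Defs
begin

text \<open>
  Mixed symmetry enters only through stabilizers. If two entries of an eigenvalue or singular value
  block of \<open>x = \<kappa>(X)\<close> agree, the transposition exchanging them fixes \<open>x\<close>, hence fixes \<open>g(x)\<close>; so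
  the corresponding entries of \<open>g(x)\<close> agree (\<open>mixed_symmetric_block_eq\<close>). If a singular value is
  zero, changing its sign fixes \<open>x\<close>; so the corresponding entry of \<open>g(x)\<close> is its own negative and
  vanishes (\<open>mixed_symmetric_block_zero\<close>).

  These coincidences are what independence of the bases needs. Two diagonalizations of the same
  Hermitian matrix differ by a unitary matrix that commutes with the diagonal of eigenvalues, so it
  is supported on pairs of equal eigenvalues and commutes with the diagonal of \<open>g(x)\<close> as well
  (\<open>eig_bases_independent\<close>). For singular values, the two changes of basis intertwine the padded
  diagonal; they vanish between different singular values, coincide on blocks of equal positive
  ones and are unrelated only where the singular values are zero, and there
  \<open>g(x)\<close> vanishes (\<open>sing_bases_independent\<close>).

  A value must also exist, and the vectors of eigenvalues and singular values, defined through
  multiplicities of roots, must have the right length. Both follow from the spectral theorem and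
  the singular value decomposition (\<open>eig_bases_nonempty\<close>, \<open>sing_bases_nonempty\<close>). The real and the
  complex case are treated at once in a locale whose only substantial assumption is that a nonempty
  Hermitian matrix has a real eigenvalue.
\<close>

section \<open>Adjoints, unitary and Hermitian matrices\<close>

lemma mult_mat_assoc:
  "dim_col A = dim_row B \<Longrightarrow> dim_col B = dim_row C \<Longrightarrow> A * B * C = A * (B * C :: 'a :: semiring_0 mat)"
  by (rule assoc_mult_mat[of A "dim_row A" "dim_col A" B "dim_col B" C "dim_col C"]) auto

lemma mult_mat_index_sum:
  assumes "A \<in> carrier_mat p q" "B \<in> carrier_mat q r" "i < p" "j < r"
  shows "(A * B) $$ (i, j) = (\<Sum>k<q. A $$ (i, k) * B $$ (k, j))"
  using assms by (auto simp: scalar_prod_def atLeast0LessThan intro!: sum.cong)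

lemma adjoint_dim [simp]:
  "dim_row (mat_adjoint A) = dim_col A" "dim_col (mat_adjoint A) = dim_row A"
  by (auto simp: mat_adjoint_def)

lemma adjoint_carrier [simp, intro]:
  "A \<in> carrier_mat p q \<Longrightarrow> mat_adjoint A \<in> carrier_mat q p"
  by (metis adjoint_dim carrier_matD carrier_matI)

lemma adjoint_index [simp]:
  assumes "i < dim_col A" "j < dim_row A"
  shows "mat_adjoint A $$ (i, j) = conjugate (A $$ (j, i))"
  using assms by (auto simp: mat_adjoint_def mat_of_rows_def)

lemma adjoint_adjoint [simp]: "mat_adjoint (mat_adjoint A) = A"
  by (rule eq_matI) auto

lemma adjoint_mult_carrier:
  assumes "A \<in> carrier_mat p q" "B \<in> carrier_mat q r"
  shows "mat_adjoint (A * B) = mat_adjoint B * mat_adjoint A"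
proof (rule eq_matI)
  fix i j assume "i < dim_row (mat_adjoint B * mat_adjoint A)" "j < dim_col (mat_adjoint B * mat_adjoint A)"
  with assms have ij: "i < r" "j < p" by auto
  have "mat_adjoint (A * B) $$ (i, j) = (\<Sum>k<q. conjugate (A $$ (j, k) * B $$ (k, i)))"
    using assms ij by (simp add: mult_mat_index_sum[OF assms] sum_conjugate del: index_mult_mat(1))
  also have "\<dots> = (\<Sum>k<q. mat_adjoint B $$ (i, k) * mat_adjoint A $$ (k, j))"
    using assms ij by (intro sum.cong) (auto simp: conjugate_dist_mul mult.commute)
  also have "\<dots> = (mat_adjoint B * mat_adjoint A) $$ (i, j)"
    using assms ij by (subst mult_mat_index_sum[of _ r q _ p]) auto
  finally show "mat_adjoint (A * B) $$ (i, j) = (mat_adjoint B * mat_adjoint A) $$ (i, j)" .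
qed (use assms in auto)

lemma adjoint_mult:
  "dim_col A = dim_row B \<Longrightarrow> mat_adjoint (A * B) = mat_adjoint B * mat_adjoint A"
  by (rule adjoint_mult_carrier[of A "dim_row A" "dim_col A" B "dim_col B"]) auto

lemma unitary_carrier: "P \<in> unitary_mats p \<Longrightarrow> P \<in> carrier_mat p p"
  by (simp add: unitary_mats_def)

lemma unitary_matsI:
  assumes "P \<in> carrier_mat p p" "P * mat_adjoint P = 1\<^sub>m p"
  shows "P \<in> unitary_mats p"
  using assms mat_mult_left_right_inverse[of P p "mat_adjoint P"] by (auto simp: unitary_mats_def)

lemma unitary_adjoint: "P \<in> unitary_mats p \<Longrightarrow> mat_adjoint P \<in> unitary_mats p"
  by (auto simp: unitary_mats_def)

lemma unitary_mult_cancel: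
  assumes "P \<in> unitary_mats p" "A \<in> carrier_mat p q"
  shows "P * (mat_adjoint P * A) = A" "mat_adjoint P * (P * A) = A"
  using assms carrier_matD[OF assms(2)] by (auto simp: unitary_mats_def simp flip: mult_mat_assoc)

lemma unitary_mult:
  assumes "P \<in> unitary_mats p" "Q \<in> unitary_mats p"
  shows "P * Q \<in> unitary_mats p"
proof (rule unitary_matsI)
  have c: "P \<in> carrier_mat p p" "Q \<in> carrier_mat p p" using assms by (auto dest: unitary_carrier)
  then show "P * Q \<in> carrier_mat p p" by simp
  have "P * Q * mat_adjoint (P * Q) = P * (Q * (mat_adjoint Q * mat_adjoint P))"
    using c[THEN carrier_matD(1)] c[THEN carrier_matD(2)] by (simp add: adjoint_mult mult_mat_assoc)
  also have "\<dots> = 1\<^sub>m p"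
    using assms c by (simp add: unitary_mult_cancel[of Q p _ p]) (simp add: unitary_mats_def)
  finally show "P * Q * mat_adjoint (P * Q) = 1\<^sub>m p" .
qed

lemma hermitian_congruence:
  assumes "A \<in> hermitian_mats p" "P \<in> carrier_mat q p"
  shows "P * A * mat_adjoint P \<in> hermitian_mats q"
proof -
  have A: "A \<in> carrier_mat p p" "mat_adjoint A = A" using assms by (auto simp: hermitian_mats_def)
  have "mat_adjoint (P * A * mat_adjoint P) = P * A * mat_adjoint P"
    using A carrier_matD[OF A(1)] carrier_matD[OF assms(2)] by (simp add: adjoint_mult mult_mat_assoc)
  then show ?thesis using A assms by (auto simp: hermitian_mats_def)
qed

section \<open>The real and the complex field\<close>

text \<open>
  The defining property of the adjoint, used to see that eigenvalues of Hermitian matrices are real.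
\<close>

lemma adjoint_mult_vec_inner:
  fixes A :: "'a :: conjugatable_field mat"
  assumes "A \<in> carrier_mat p q" "v \<in> carrier_vec q" "w \<in> carrier_vec p"
  shows "(A *\<^sub>v v) \<bullet>c w = v \<bullet>c (mat_adjoint A *\<^sub>v w)"
proof -
  have "(A *\<^sub>v v) \<bullet>c w = (\<Sum>i<p. \<Sum>j<q. A $$ (i, j) * v $ j * conjugate (w $ i))"
    using assms by (auto simp: scalar_prod_def atLeast0LessThan sum_distrib_right intro!: sum.cong)
  also have "\<dots> = (\<Sum>j<q. \<Sum>i<p. A $$ (i, j) * v $ j * conjugate (w $ i))"
    by (rule sum.swap)
  also have "\<dots> = v \<bullet>c (mat_adjoint A *\<^sub>v w)"
    using assms by (auto simp: scalar_prod_def atLeast0LessThan sum_distrib_left sum_conjugate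
        conjugate_dist_mul mult_ac intro!: sum.cong)
  finally show ?thesis .
qed

text \<open>
  The fundamental theorem of algebra gives an eigenvalue \<open>e\<close> with an eigenvector \<open>v\<close>; moving
  \<open>A\<close> across the inner product \<open>\<langle>A v, v\<rangle>\<close> turns \<open>e\<close> into its conjugate.
\<close>

lemma complex_hermitian_real_eigenvalue:
  fixes A :: "complex mat"
  assumes A: "A \<in> hermitian_mats p" and "p > 0"
  shows "\<exists>x::real. eigenvalue A (of_real x)"
proof -
  have c: "A \<in> carrier_mat p p" and h: "mat_adjoint A = A"
    using A by (auto simp: hermitian_mats_def)
  have "degree (char_poly A) \<noteq> 0" using degree_monic_char_poly[OF c] \<open>p > 0\<close> by auto
  then obtain e where e: "poly (char_poly A) e = 0"
    using fundamental_theorem_of_algebra constant_degree by metis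
  then have ev: "eigenvalue A e" by (simp add: eigenvalue_root_char_poly[OF c])
  then obtain v where v: "v \<in> carrier_vec p" "v \<noteq> 0\<^sub>v p" "A *\<^sub>v v = e \<cdot>\<^sub>v v"
    using c by (auto simp: eigenvalue_def eigenvector_def)
  have "e * (v \<bullet>c v) = (A *\<^sub>v v) \<bullet>c v" using v by simp
  also have "\<dots> = v \<bullet>c (A *\<^sub>v v)" using adjoint_mult_vec_inner[OF c v(1) v(1)] h by simp
  also have "\<dots> = cnj e * (v \<bullet>c v)" using v by (simp add: conjugate_smult_vec)
  finally have "e = cnj e" using v conjugate_square_eq_0_vec[OF v(1)] by simp
  then have "e = of_real (Re e)" by (simp add: complex_eq_iff)
  with ev show ?thesis by metis
qed

text \<open>
  A real symmetric matrix is Hermitian over the complex numbers. Its real eigenvalue there is a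
  root of the characteristic polynomial, which has real coefficients, so it is an eigenvalue over
  the reals too.
\<close>

lemma real_hermitian_real_eigenvalue:
  fixes A :: "real mat"
  assumes A: "A \<in> hermitian_mats p" and "p > 0"
  shows "\<exists>x::real. eigenvalue A (of_real x)"
proof -
  have c: "A \<in> carrier_mat p p" and h: "mat_adjoint A = A"
    using A by (auto simp: hermitian_mats_def)
  let ?C = "map_mat complex_of_real A"
  have "mat_adjoint ?C = ?C"
  proof (rule eq_matI)
    fix i j assume "i < dim_row ?C" "j < dim_col ?C"
    then have ij: "i < p" "j < p" using c by auto
    have "mat_adjoint A $$ (i, j) = A $$ (i, j)" using h by simp
    then show "mat_adjoint ?C $$ (i, j) = ?C $$ (i, j)" using ij c by simp
  qed (use c in auto)
  then have "?C \<in> hermitian_mats p" using c by (simp add: hermitian_mats_def)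
  then obtain x :: real where "eigenvalue ?C (of_real x)"
    using complex_hermitian_real_eigenvalue \<open>p > 0\<close> by blast
  then have "poly (map_poly complex_of_real (char_poly A)) (of_real x) = 0"
    using c by (simp add: eigenvalue_root_char_poly[of _ p] of_real_hom.char_poly_hom[OF c])
  then have "poly (char_poly A) x = 0" by simp
  then show ?thesis by (auto simp: eigenvalue_root_char_poly[OF c])
qed

text \<open>
  The three facts about the scalars on which everything below rests, so that the real and the
  complex case share one proof. The last one is the substantial one; the spectral theorem follows
  from it by induction on the size.
\<close>

locale spectral_field =
  fixes field_ty :: "'a :: {conjugatable_field, real_field} itself"
  assumes conjugate_of_real [simp]: "\<And>r. conjugate (of_real r :: 'a) = of_real r"
    and ex_self_conjugate_real: "\<And>x :: 'a. \<exists>r\<ge>0. x * conjugate x = of_real r"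
    and ex_hermitian_real_eigenvalue:
      "\<And>(A :: 'a mat) p. A \<in> hermitian_mats p \<Longrightarrow> p > 0 \<Longrightarrow> \<exists>r. eigenvalue A (of_real r)"

interpretation real_field: spectral_field "TYPE(real)"
proof
  fix x :: real
  show "\<exists>r\<ge>0. x * conjugate x = of_real r" by (rule exI[of _ "x * x"]) simp
qed (auto dest: real_hermitian_real_eigenvalue)

interpretation complex_field: spectral_field "TYPE(complex)"
proof
  fix x :: complex
  show "\<exists>r\<ge>0. x * conjugate x = of_real r"
    by (rule exI[of _ "(norm x)\<^sup>2"]) (simp add: complex_norm_square del: of_real_power)
qed (auto intro: complex_hermitian_real_eigenvalue)

context spectral_field
begin

lemma conjugate_one [simp]: "conjugate (1 :: 'a) = 1"
  using conjugate_of_real[of 1] by simp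


section \<open>Orthonormal families\<close>

text \<open>
  Positive definiteness of the inner product, with the norm expressed as a real number so that
  square roots can be taken.
\<close>

lemma inner_self_real:
  fixes v :: "'a vec"
  assumes "v \<in> carrier_vec p"
  shows "\<exists>r\<ge>0. v \<bullet>c v = of_real r \<and> (r = 0 \<longrightarrow> v = 0\<^sub>v p)"
proof -
  obtain r where r: "\<And>x :: 'a. r x \<ge> 0" "\<And>x :: 'a. x * conjugate x = of_real (r x)"
    using ex_self_conjugate_real by metis
  let ?s = "\<Sum>i<p. r (v $ i)"
  have "v \<bullet>c v = of_real ?s"
    using assms by (auto simp: scalar_prod_def atLeast0LessThan r(2) intro!: sum.cong)
  moreover have "v = 0\<^sub>v p" if "?s = 0"
  proof (rule eq_vecI)
    fix i assume "i < dim_vec (0\<^sub>v p :: 'a vec)"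
    then have "r (v $ i) = 0" "i < p" using that r(1) by (auto simp: sum_nonneg_eq_0_iff)
    then show "v $ i = 0\<^sub>v p $ i" using r(2)[of "v $ i"] by simp
  qed (use assms in auto)
  ultimately show ?thesis using r(1) by (intro exI[of _ ?s]) (auto intro: sum_nonneg)
qed

lemma ex_unit_multiple:
  fixes v :: "'a vec"
  assumes "v \<in> carrier_vec p" "v \<noteq> 0\<^sub>v p"
  shows "\<exists>c. (c \<cdot>\<^sub>v v) \<bullet>c (c \<cdot>\<^sub>v v) = 1"
proof -
  obtain r where r: "r > 0" "v \<bullet>c v = of_real r"
    using inner_self_real[OF assms(1)] assms(2) by (auto simp: le_less)
  let ?c = "of_real (1 / sqrt r) :: 'a"
  have "(?c \<cdot>\<^sub>v v) \<bullet>c (?c \<cdot>\<^sub>v v) = ?c * ?c * (v \<bullet>c v)"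
    using assms(1) conjugate_of_real[of "1 / sqrt r"] by (simp add: conjugate_smult_vec)
  also have "\<dots> = of_real (1 / sqrt r * (1 / sqrt r) * r)"
    unfolding r(2) of_real_mult ..
  also have "1 / sqrt r * (1 / sqrt r) * r = 1" using r(1) by simp
  finally show ?thesis by (metis of_real_1)
qed

text \<open>
  Orthogonality to fewer than \<open>q\<close> vectors is a homogeneous linear system with fewer than \<open>q\<close>
  equations. Padded with zero rows it has a square matrix of determinant zero, so there is a
  nontrivial solution.
\<close>

lemma ex_unit_orthogonal:
  fixes f :: "nat \<Rightarrow> 'a vec"
  assumes f: "\<And>i. i \<in> S \<Longrightarrow> f i \<in> carrier_vec q" and x: "x < q" "x \<notin> S"
  shows "\<exists>w\<in>carrier_vec q. w \<bullet>c w = 1 \<and> (\<forall>i\<in>S \<inter> {..<q}. w \<bullet>c f i = 0)"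
proof -
  define M where "M = mat q q (\<lambda>(i, j). if i \<in> S then conjugate (f i $ j) else 0)"
  have M: "M \<in> carrier_mat q q" by (simp add: M_def)
  have "transpose_mat M *\<^sub>v unit_vec q x = 0\<^sub>v q"
    using x by (intro eq_vecI) (auto simp: M_def)
  moreover have "unit_vec q x \<noteq> (0\<^sub>v q :: 'a vec)"
    using x by (metis index_unit_vec(1) index_zero_vec(1) zero_neq_one)
  ultimately have "det (transpose_mat M) = 0"
    using det_0_iff_vec_prod_zero_field[of "transpose_mat M" q] M unit_vec_carrier[of q x]
    by (metis transpose_carrier_mat)
  then have "det M = 0" using det_transpose[OF M] by simp
  then obtain v where v: "v \<in> carrier_vec q" "v \<noteq> 0\<^sub>v q" "M *\<^sub>v v = 0\<^sub>v q"
    using det_0_iff_vec_prod_zero_field[OF M] by blast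
  obtain c where c: "(c \<cdot>\<^sub>v v) \<bullet>c (c \<cdot>\<^sub>v v) = 1" using ex_unit_multiple[OF v(1,2)] by blast
  have "(c \<cdot>\<^sub>v v) \<bullet>c f i = 0" if i: "i \<in> S" "i < q" for i
  proof -
    have "row M i = conjugate (f i)"
      using i f[OF i(1)] by (intro eq_vecI) (auto simp: M_def)
    then have "conjugate (f i) \<bullet> v = 0"
      using arg_cong[OF v(3), of "\<lambda>u. u $ i"] i M by simp
    then have "v \<bullet>c f i = 0" using v(1) f[OF i(1)] by (simp add: conjugate_vec_sprod_comm)
    then show ?thesis using v(1) f[OF i(1)] by simp
  qed
  then show ?thesis using v(1) c by (intro bexI[of _ "c \<cdot>\<^sub>v v"]) auto
qed

text \<open>
  Every orthonormal family, indexed by any subset of the row indices, consists of rows of a unitary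
  matrix: fill the missing rows \<open>T\<close> one at a time. Placing the given vectors at prescribed indices
  avoids reordering rows when the family comes from the nonzero singular values.
\<close>

lemma ex_unitary_extension:
  fixes f :: "nat \<Rightarrow> 'a vec"
  assumes "finite T" "T \<subseteq> {..<q}"
    and "\<And>i. i \<in> {..<q} - T \<Longrightarrow> f i \<in> carrier_vec q"
    and "\<And>i j. i \<in> {..<q} - T \<Longrightarrow> j \<in> {..<q} - T \<Longrightarrow> f i \<bullet>c f j = (if i = j then 1 else 0)"
  shows "\<exists>V\<in>unitary_mats q. \<forall>i\<in>{..<q} - T. row V i = f i"
  using assms
proof (induction T arbitrary: f rule: finite_induct)
  case empty
  let ?V = "mat q q (\<lambda>(i, j). f i $ j)"
  have row: "row ?V i = f i" if "i < q" for i
    using empty.prems(2)[of i] that by (intro eq_vecI) auto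
  have "?V * mat_adjoint ?V = 1\<^sub>m q"
  proof (rule eq_matI)
    fix i j assume "i < dim_row (1\<^sub>m q :: 'a mat)" "j < dim_col (1\<^sub>m q :: 'a mat)"
    then have ij: "i < q" "j < q" by auto
    have "(?V * mat_adjoint ?V) $$ (i, j) = row ?V i \<bullet> col (mat_adjoint ?V) j" using ij by simp
    also have "col (mat_adjoint ?V) j = conjugate (row ?V j)"
      using ij by (intro eq_vecI) auto
    finally show "(?V * mat_adjoint ?V) $$ (i, j) = 1\<^sub>m q $$ (i, j)"
      using empty.prems(3)[of i j] ij unfolding row[OF ij(1)] row[OF ij(2)] by simp
  qed auto
  then have "?V \<in> unitary_mats q" by (intro unitary_matsI) auto
  then show ?case using row by blast
next
  case (insert x T)
  have x: "x < q" "x \<notin> {..<q} - insert x T" using insert.prems by auto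
  obtain w where w: "w \<in> carrier_vec q" "w \<bullet>c w = 1" "\<And>i. i \<in> {..<q} - insert x T \<Longrightarrow> w \<bullet>c f i = 0"
    using ex_unit_orthogonal[of "{..<q} - insert x T" f q x] insert.prems(2) x by fastforce
  have w': "f i \<bullet>c w = 0" if "i \<in> {..<q} - insert x T" for i
  proof -
    have fi: "f i \<in> carrier_vec q" using insert.prems(2)[OF that] .
    have "conjugate (w \<bullet>c f i) = 0" using w(3)[OF that] by simp
    then show ?thesis
      using conjugate_sprod_vec[of w q "conjugate (f i)"] w(1) fi
      by (simp add: comm_scalar_prod[of "conjugate w" q "f i"])
  qed
  let ?f = "f(x := w)"
  have "\<exists>V\<in>unitary_mats q. \<forall>i\<in>{..<q} - T. row V i = ?f i"
  proof (rule insert.IH)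
    fix i assume "i \<in> {..<q} - T"
    then show "?f i \<in> carrier_vec q" using insert.prems(2)[of i] w by auto
  next
    fix i j assume ij: "i \<in> {..<q} - T" "j \<in> {..<q} - T"
    show "?f i \<bullet>c ?f j = (if i = j then 1 else 0)"
      using ij w w' insert.prems(3)[of i j] by (cases "i = x"; cases "j = x") auto
  qed (use insert.prems in auto)
  then obtain V where V: "V \<in> unitary_mats q" "\<And>i. i \<in> {..<q} - T \<Longrightarrow> row V i = ?f i" by blast
  have "row V i = f i" if "i \<in> {..<q} - insert x T" for i
    using V(2)[of i] that by auto
  with V(1) show ?case by blast
qed

section \<open>The spectral theorem\<close>

lemma Diag_pad_carrier [simp, intro]: "dim_vec x = p \<Longrightarrow> Diag_pad q x \<in> carrier_mat p q"
  by (auto simp: Diag_pad_def)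

lemma Diag_dim [simp]: "dim_row (Diag x) = dim_vec x" "dim_col (Diag x) = dim_vec x"
  by (simp_all add: Diag_def mat_diag_def)

lemma Diag_pad_dim [simp]: "dim_row (Diag_pad q x) = dim_vec x" "dim_col (Diag_pad q x) = q"
  by (simp_all add: Diag_pad_def)

lemma Diag_eq_Diag_pad: "dim_vec x = p \<Longrightarrow> Diag x = (Diag_pad p x :: 'a mat)"
  by (rule eq_matI) (auto simp: Diag_def Diag_pad_def mat_diag_def)

lemma mult_Diag_pad_index:
  assumes "(A :: 'a mat) \<in> carrier_mat r p" "dim_vec x = p" "i < r" "j < q"
  shows "(A * Diag_pad q x) $$ (i, j) = (if j < p then A $$ (i, j) * of_real (x $ j) else 0)"
proof -
  have "(A * Diag_pad q x) $$ (i, j) = (\<Sum>k<p. A $$ (i, k) * Diag_pad q x $$ (k, j))"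
    using assms by (intro mult_mat_index_sum) auto
  also have "\<dots> = (\<Sum>k<p. if k = j then A $$ (i, j) * of_real (x $ j) else 0)"
    using assms by (intro sum.cong) (auto simp: Diag_pad_def)
  also have "\<dots> = (if j < p then A $$ (i, j) * of_real (x $ j) else 0)" by (simp add: sum.delta)
  finally show ?thesis .
qed

lemma Diag_pad_mult_index:
  assumes "(B :: 'a mat) \<in> carrier_mat q r" "dim_vec x = p" "p \<le> q" "i < p" "j < r"
  shows "(Diag_pad q x * B) $$ (i, j) = of_real (x $ i) * B $$ (i, j)"
proof -
  have "(Diag_pad q x * B) $$ (i, j) = (\<Sum>k<q. Diag_pad q x $$ (i, k) * B $$ (k, j))"
    using assms by (intro mult_mat_index_sum[of _ p _ _ r]) auto
  also have "\<dots> = (\<Sum>k<q. if k = i then of_real (x $ i) * B $$ (i, j) else 0)"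
    using assms by (intro sum.cong) (auto simp: Diag_pad_def)
  also have "\<dots> = of_real (x $ i) * B $$ (i, j)" using assms by (simp add: sum.delta)
  finally show ?thesis .
qed

lemma Diag_hermitian: "dim_vec x = p \<Longrightarrow> (Diag x :: 'a mat) \<in> hermitian_mats p"
  by (auto simp: hermitian_mats_def Diag_def mat_diag_def intro!: eq_matI)

lemma diag_congruence_index:
  fixes P :: "'a mat"
  assumes "P \<in> carrier_mat r p" "dim_vec x = p" "i < r" "j < r"
  shows "(P * Diag x * mat_adjoint P) $$ (i, j) =
    (\<Sum>k<p. P $$ (i, k) * of_real (x $ k) * conjugate (P $$ (j, k)))"
proof -
  have "(P * Diag x * mat_adjoint P) $$ (i, j) = (\<Sum>k<p. (P * Diag x) $$ (i, k) * mat_adjoint P $$ (k, j))"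
    using assms by (intro mult_mat_index_sum[of _ r _ _ r]) (auto simp: Diag_eq_Diag_pad)
  then show ?thesis
    using assms by (simp add: Diag_eq_Diag_pad mult_Diag_pad_index del: index_mult_mat(1))
qed

text \<open>
  Take a unit eigenvector as first column of a unitary matrix. In the new basis the first column
  of the matrix is a multiple of the first unit vector, and Hermitian symmetry clears the first row
  as well.
\<close>

lemma hermitian_deflate:
  fixes A :: "'a mat"
  assumes A: "A \<in> hermitian_mats (Suc p)"
  shows "\<exists>U B r. U \<in> unitary_mats (Suc p) \<and> B \<in> hermitian_mats p \<and>
    A = U * four_block_mat (mat 1 1 (\<lambda>_. of_real r)) (0\<^sub>m 1 p) (0\<^sub>m p 1) B * mat_adjoint U"
proof -
  have c: "A \<in> carrier_mat (Suc p) (Suc p)" using A by (auto simp: hermitian_mats_def)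
  obtain r v0 where v0: "v0 \<in> carrier_vec (Suc p)" "v0 \<noteq> 0\<^sub>v (Suc p)" "A *\<^sub>v v0 = of_real r \<cdot>\<^sub>v v0"
    using ex_hermitian_real_eigenvalue[OF A] c by (auto simp: eigenvalue_def eigenvector_def)
  obtain k where k: "(k \<cdot>\<^sub>v v0) \<bullet>c (k \<cdot>\<^sub>v v0) = 1" using ex_unit_multiple[OF v0(1,2)] by blast
  define v where "v = k \<cdot>\<^sub>v v0"
  have v: "v \<in> carrier_vec (Suc p)" "v \<bullet>c v = 1" using v0 k by (auto simp: v_def)
  have Av: "A *\<^sub>v v = of_real r \<cdot>\<^sub>v v"
    using v0 c by (auto simp: v_def mult_mat_vec smult_smult_assoc mult.commute)
  \<comment> \<open>the extension lemma prescribes rows; the row \<open>conjugate v\<close> becomes the column \<open>v\<close> of the adjoint\<close>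
  have "conjugate v \<bullet>c conjugate v = 1"
    using v by (simp add: comm_scalar_prod[of "conjugate v" "Suc p" v])
  then obtain V where V: "V \<in> unitary_mats (Suc p)" "row V 0 = conjugate v"
    using ex_unitary_extension[of "{1..p}" "Suc p" "\<lambda>_. conjugate v"] v by fastforce
  define U where "U = mat_adjoint V"
  have cV: "V \<in> carrier_mat (Suc p) (Suc p)" using V by (simp add: unitary_carrier)
  then have cU: "U \<in> carrier_mat (Suc p) (Suc p)" by (simp add: U_def)
  note dims = carrier_matD[OF c] carrier_matD[OF cU] carrier_matD[OF cV]
  have U: "U \<in> unitary_mats (Suc p)" "mat_adjoint U = V" using V by (auto simp: U_def unitary_adjoint)
  have colU: "col U 0 = v"
  proof (rule eq_vecI)
    fix i assume "i < dim_vec v"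
    then have i: "i < Suc p" using v by auto
    have "col U 0 $ i = conjugate (row V 0 $ i)" using i cV by (simp add: U_def)
    also have "\<dots> = v $ i" using i v V(2) by simp
    finally show "col U 0 $ i = v $ i" .
  qed (use cU v in auto)
  define C where "C = V * A * U"
  have C: "C \<in> hermitian_mats (Suc p)"
    using hermitian_congruence[OF A cV] by (simp add: C_def U_def)
  then have cC: "C \<in> carrier_mat (Suc p) (Suc p)" and hC: "mat_adjoint C = C"
    by (auto simp: hermitian_mats_def)
  have A_eq: "A = U * C * mat_adjoint U"
  proof -
    have "U * C * mat_adjoint U = U * (V * (A * (U * V)))"
      by (simp add: C_def U(2) mult_mat_assoc dims)
    also have "U * V = 1\<^sub>m (Suc p)" using U by (auto simp: unitary_mats_def)
    also have "U * (V * (A * 1\<^sub>m (Suc p))) = A"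
      using unitary_mult_cancel(1)[OF U(1) c] U(2) c by simp
    finally show ?thesis by simp
  qed
  have col0: "C $$ (i, 0) = (if i = 0 then of_real r else 0)" if i: "i < Suc p" for i
  proof -
    have "C $$ (i, 0) = row V i \<bullet> col (A * U) 0"
      using i by (simp add: C_def mult_mat_assoc dims)
    also have "col (A * U) 0 = of_real r \<cdot>\<^sub>v col U 0"
      unfolding col_mult2[OF c cU zero_less_Suc] colU by (rule Av)
    also have "row V i \<bullet> (of_real r \<cdot>\<^sub>v col U 0) = of_real r * (V * U) $$ (i, 0)"
      using i cU cV by simp
    also have "V * U = 1\<^sub>m (Suc p)" using U by (auto simp: unitary_mats_def)
    finally show ?thesis using i by simp
  qed
  have row0: "C $$ (0, i) = (if i = 0 then of_real r else 0)" if i: "i < Suc p" for i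
  proof -
    have "C $$ (0, i) = mat_adjoint C $$ (0, i)" using hC by simp
    also have "\<dots> = conjugate (C $$ (i, 0))" using i cC by simp
    finally show ?thesis using col0[OF i] by simp
  qed
  define B where "B = mat p p (\<lambda>(i, j). C $$ (Suc i, Suc j))"
  have "conjugate (C $$ (Suc j, Suc i)) = C $$ (Suc i, Suc j)" if "i < p" "j < p" for i j
    using adjoint_index[of "Suc i" C "Suc j"] hC cC that by simp
  then have "B \<in> hermitian_mats p"
    by (auto simp: hermitian_mats_def B_def intro!: eq_matI)
  moreover have "C = four_block_mat (mat 1 1 (\<lambda>_. of_real r)) (0\<^sub>m 1 p) (0\<^sub>m p 1) B"
    using cC by (intro eq_matI) (auto simp: B_def col0 row0)
  ultimately show ?thesis using A_eq U by blast
qed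

lemma block_diag_mult:
  fixes A A' B B' :: "'a mat"
  assumes "A \<in> carrier_mat r r" "A' \<in> carrier_mat r r" "B \<in> carrier_mat p p" "B' \<in> carrier_mat p p"
  shows "four_block_mat A (0\<^sub>m r p) (0\<^sub>m p r) B * four_block_mat A' (0\<^sub>m r p) (0\<^sub>m p r) B' =
    four_block_mat (A * A') (0\<^sub>m r p) (0\<^sub>m p r) (B * B')"
  using assms by (subst mult_four_block_mat[of _ r r _ p _ p _ _ r _ p]) auto

text \<open>
  Induction on the size, splitting off one eigenvector at a time. The eigenvalues come in no
  particular order.
\<close>

lemma spectral_theorem:
  fixes A :: "'a mat"
  assumes "A \<in> hermitian_mats p"
  shows "\<exists>P d. P \<in> unitary_mats p \<and> dim_vec d = p \<and> A = P * Diag d * mat_adjoint P"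
  using assms
proof (induction p arbitrary: A)
  case 0
  then have "A = 1\<^sub>m 0 * Diag (vec 0 (\<lambda>_. 0)) * mat_adjoint (1\<^sub>m 0)"
    by (intro eq_matI) (auto simp: hermitian_mats_def)
  moreover have "(1\<^sub>m 0 :: 'a mat) \<in> unitary_mats 0"
    by (intro unitary_matsI eq_matI) auto
  ultimately show ?case by (metis dim_vec)
next
  case (Suc p)
  obtain U B r where U: "U \<in> unitary_mats (Suc p)" and B: "B \<in> hermitian_mats p" and
    A: "A = U * four_block_mat (mat 1 1 (\<lambda>_. of_real r)) (0\<^sub>m 1 p) (0\<^sub>m p 1) B * mat_adjoint U"
    using hermitian_deflate[OF Suc.prems] by blast
  obtain Q d where Q: "Q \<in> unitary_mats p" and d: "dim_vec d = p" and B_eq: "B = Q * Diag d * mat_adjoint Q"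
    using Suc.IH[OF B] by blast
  have c: "Q \<in> carrier_mat p p" "U \<in> carrier_mat (Suc p) (Suc p)" "(Diag d :: 'a mat) \<in> carrier_mat p p"
    using U Q d by (auto simp: unitary_carrier Diag_eq_Diag_pad)
  define R where "R = four_block_mat (1\<^sub>m 1) (0\<^sub>m 1 p) (0\<^sub>m p 1) Q"
  have cR: "R \<in> carrier_mat (Suc p) (Suc p)" using c by (auto simp: R_def)
  have adjR: "mat_adjoint R = four_block_mat (1\<^sub>m 1) (0\<^sub>m 1 p) (0\<^sub>m p 1) (mat_adjoint Q)"
    using c by (intro eq_matI) (auto simp: R_def)
  have "R * mat_adjoint R = four_block_mat (1\<^sub>m 1) (0\<^sub>m 1 p) (0\<^sub>m p 1) (1\<^sub>m p)"
    using Q c unfolding adjR unfolding R_def by (simp add: block_diag_mult unitary_mats_def)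
  also have "\<dots> = 1\<^sub>m (Suc p)" by (intro eq_matI) auto
  finally have R: "R \<in> unitary_mats (Suc p)" using cR by (intro unitary_matsI) auto
  have dd: "Diag (vCons r d) = four_block_mat (mat 1 1 (\<lambda>_. of_real r :: 'a)) (0\<^sub>m 1 p) (0\<^sub>m p 1) (Diag d)"
    using d by (intro eq_matI) (auto simp: Diag_def mat_diag_def vec_index_vCons)
  have "R * Diag (vCons r d) * mat_adjoint R = four_block_mat (mat 1 1 (\<lambda>_. of_real r)) (0\<^sub>m 1 p) (0\<^sub>m p 1) B"
    using c unfolding adjR dd B_eq unfolding R_def by (simp add: block_diag_mult)
  then have "A = U * (R * Diag (vCons r d) * mat_adjoint R) * mat_adjoint U" using A by simp
  also have "\<dots> = (U * R) * Diag (vCons r d) * mat_adjoint (U * R)"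
    using carrier_matD[OF c(2)] carrier_matD[OF cR] d
    by (simp add: adjoint_mult mult_mat_assoc)
  finally show ?case using unitary_mult[OF U R] d by (metis dim_vec_vCons)
qed


section \<open>Ordered eigenvalues\<close>

lemma char_poly_diag_congruence:
  fixes P :: "'a mat"
  assumes P: "P \<in> unitary_mats p" and d: "dim_vec d = p"
  shows "char_poly (P * Diag d * mat_adjoint P) = (\<Prod>x\<leftarrow>list_of_vec d. [:- of_real x, 1:])"
proof -
  have c: "P \<in> carrier_mat p p" "(Diag d :: 'a mat) \<in> carrier_mat p p"
    using P d by (auto simp: unitary_carrier Diag_eq_Diag_pad)
  have "similar_mat (P * Diag d * mat_adjoint P) (Diag d)"
    using P c by (intro similar_matI[of _ _ P "mat_adjoint P" p]) (auto simp: unitary_mats_def)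
  then have "char_poly (P * Diag d * mat_adjoint P) = char_poly (Diag d)" by (rule char_poly_similar)
  also have "\<dots> = (\<Prod>a\<leftarrow>diag_mat (Diag d). [:- a, 1:])"
    using c by (intro char_poly_upper_triangular) (auto simp: upper_triangular_def Diag_def mat_diag_def)
  also have "diag_mat (Diag d) = map of_real (list_of_vec d :: real list)"
    by (intro nth_equalityI) (auto simp: diag_mat_def Diag_def mat_diag_def list_of_vec_index)
  finally show ?thesis by (simp add: o_def)
qed

text \<open>
  Unitary congruence with \<open>Diag d\<close> is a similarity, so the characteristic polynomial is
  \<open>\<Prod>\<^sub>i (X - d\<^sub>i)\<close>; hence the algebraic multiplicities count the entries of \<open>d\<close>.
\<close>

lemma eigval_mset_diag_congruence:
  fixes P :: "'a mat"
  assumes P: "P \<in> unitary_mats p" and d: "dim_vec d = p"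
  shows "eigval_mset (P * Diag d * mat_adjoint P) = mset (list_of_vec d)"
proof (rule multiset_eqI)
  fix y :: real
  let ?A = "P * Diag d * mat_adjoint P"
  have c: "?A \<in> carrier_mat p p"
    using carrier_matD[OF unitary_carrier[OF P]] by (intro carrier_matI) simp_all
  have cp: "char_poly ?A \<noteq> 0" using degree_monic_char_poly[OF c] by auto
  have ev: "eigenvalue ?A e \<longleftrightarrow> order e (char_poly ?A) \<noteq> 0" for e
    using order_root[of "char_poly ?A" e] cp by (simp add: eigenvalue_root_char_poly[OF c])
  have order: "order (of_real x) (char_poly ?A) = count (mset (list_of_vec d)) x" for x
  proof -
    have lin: "order (of_real x) [:- of_real y :: 'a, 1:] = (if x = y then 1 else 0)" for y :: real
      using order_power_n_n[of "of_real y :: 'a" 1] by (auto intro: order_0I)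
    have "order (of_real x) (\<Prod>y\<leftarrow>ys. [:- of_real y :: 'a, 1:]) = count (mset ys) x" for ys
    proof -
      have "(\<Sum>y\<leftarrow>ys. if x = y then 1 else 0 :: nat) = count (mset ys) x" by (induction ys) auto
      then show ?thesis by (subst order_prod_list) (auto simp: o_def lin)
    qed
    then show ?thesis by (simp add: char_poly_diag_congruence[OF P d])
  qed
  have "{x. eigenvalue ?A (of_real x)} = set (list_of_vec d)"
    by (simp add: ev order)
  then have "count (eigval_mset ?A) y = (\<Sum>x\<in>set (list_of_vec d). if x = y then count (mset (list_of_vec d)) y else 0)"
    by (auto simp: eigval_mset_def count_sum order intro!: sum.cong)
  also have "\<dots> = count (mset (list_of_vec d)) y"
    by (simp add: sum.delta)
  finally show "count (eigval_mset ?A) y = count (mset (list_of_vec d)) y" .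
qed

text \<open>
  The diagonal of any diagonalization is a permutation of the ordered eigenvalues, so permuting the
  columns of the unitary factor accordingly gives a member of \<open>eig_bases\<close>.
\<close>

lemma eig_bases_nonempty:
  fixes A :: "'a mat"
  assumes A: "A \<in> hermitian_mats p"
  shows "dim_vec (eigval_vec A) = p" "eig_bases A \<noteq> {}"
proof -
  obtain P d where P: "P \<in> unitary_mats p" and d: "dim_vec d = p" and A_eq: "A = P * Diag d * mat_adjoint P"
    using spectral_theorem[OF A] by blast
  have c: "P \<in> carrier_mat p p" using P by (rule unitary_carrier)
  let ?e = "eigval_vec A"
  let ?ds = "list_of_vec d" and ?es = "rev (sorted_list_of_multiset (eigval_mset A))"
  have es: "?e = vec_of_list ?es" by (simp add: eigval_vec_def)
  have mset: "mset ?es = mset ?ds"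
    using eigval_mset_diag_congruence[OF P d] by (simp add: A_eq)
  then have len: "length ?es = p" using d by (metis Matrix.length_list_of_vec mset_eq_length)
  then show dim: "dim_vec ?e = p" by (simp add: es)
  obtain \<pi> where pi: "\<pi> permutes {..<p}" "permute_list \<pi> ?ds = ?es"
    using mset_eq_permutation[OF mset] d by auto
  have pi_less: "\<pi> i < p" if "i < p" for i using permutes_in_image[OF pi(1)] that by simp
  have e: "?e $ i = d $ \<pi> i" if "i < p" for i
  proof -
    have "?e $ i = permute_list \<pi> ?ds ! i"
      using that len by (simp add: es pi(2) vec_of_list_index)
    also have "\<dots> = d $ \<pi> i"
      using pi(1) that d pi_less by (simp add: permute_list_nth list_of_vec_index)
    finally show ?thesis .
  qed
  define Q where "Q = mat p p (\<lambda>(i, j). P $$ (i, \<pi> j))"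
  have cQ: "Q \<in> carrier_mat p p" by (simp add: Q_def)
  \<comment> \<open>with \<open>x = 1\<close> this makes \<open>Q\<close> unitary, with \<open>x = d\<close> it is the diagonalization by \<open>Q\<close>\<close>
  have reindex: "(\<Sum>k<p. Q $$ (i, k) * of_real (x (\<pi> k)) * conjugate (Q $$ (j, k)))
      = (\<Sum>k<p. P $$ (i, k) * of_real (x k) * conjugate (P $$ (j, k)))"
    if "i < p" "j < p" for i j x
    using that sum.permute[OF pi(1), of "\<lambda>k. P $$ (i, k) * of_real (x k) * conjugate (P $$ (j, k))"]
    by (simp add: Q_def o_def)
  have "Q * mat_adjoint Q = P * mat_adjoint P"
  proof (rule eq_matI)
    fix i j assume "i < dim_row (P * mat_adjoint P)" "j < dim_col (P * mat_adjoint P)"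
    then have ij: "i < p" "j < p" using c by auto
    then show "(Q * mat_adjoint Q) $$ (i, j) = (P * mat_adjoint P) $$ (i, j)"
      using reindex[OF ij, of "\<lambda>_. 1"] c cQ
      by (simp add: mult_mat_index_sum[of _ p p _ p] del: index_mult_mat(1))
  qed (use c cQ in auto)
  then have Q: "Q \<in> unitary_mats p"
    using P cQ by (intro unitary_matsI) (auto simp: unitary_mats_def)
  have "A = Q * Diag ?e * mat_adjoint Q"
  proof (rule eq_matI)
    fix i j assume "i < dim_row (Q * Diag ?e * mat_adjoint Q)" "j < dim_col (Q * Diag ?e * mat_adjoint Q)"
    then have ij: "i < p" "j < p" using cQ by auto
    have "A $$ (i, j) = (\<Sum>k<p. P $$ (i, k) * of_real (d $ k) * conjugate (P $$ (j, k)))"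
      using diag_congruence_index[OF c d ij] by (simp only: A_eq)
    also have "\<dots> = (\<Sum>k<p. Q $$ (i, k) * of_real (?e $ k) * conjugate (Q $$ (j, k)))"
      unfolding reindex[OF ij, symmetric] by (intro sum.cong) (auto simp: e)
    also have "\<dots> = (Q * Diag ?e * mat_adjoint Q) $$ (i, j)"
      using diag_congruence_index[OF cQ dim ij] by simp
    finally show "A $$ (i, j) = (Q * Diag ?e * mat_adjoint Q) $$ (i, j)" .
  qed (use c cQ A_eq in auto)
  moreover have "dim_row A = p" using A by (auto simp: hermitian_mats_def)
  ultimately show "eig_bases A \<noteq> {}" using Q by (auto simp: eig_bases_def)
qed

section \<open>The singular value decomposition\<close>

lemma gram_index:
  fixes W :: "'a mat"
  assumes "W \<in> carrier_mat p q" "i < p" "j < p"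
  shows "(W * mat_adjoint W) $$ (i, j) = row W i \<bullet>c row W j"
proof -
  have "col (mat_adjoint W) j = conjugate (row W j)" using assms by (intro eq_vecI) auto
  then show ?thesis using assms by simp
qed

text \<open>
  Diagonalize \<open>Z Z\<^sup>* = P Diag(d) P\<^sup>*\<close>. The rows of \<open>W = P\<^sup>* Z\<close> are then orthogonal with squared
  norms \<open>d\<^sub>i\<close>. This shows \<open>d \<ge> 0\<close>, and the nonzero rows, divided by their norms \<open>\<sigma>\<^sub>i\<close>, extend to a
  unitary matrix \<open>V\<close> with \<open>W = [Diag(\<sigma>) 0] V\<close>.
\<close>

lemma sing_bases_nonempty:
  fixes Z :: "'a mat"
  assumes Z: "Z \<in> carrier_mat p q" and "p \<le> q"
  shows "dim_vec (singval_vec Z) = p" "\<And>i. i < p \<Longrightarrow> singval_vec Z $ i \<ge> 0" "sing_bases Z \<noteq> {}"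
proof -
  let ?A = "Z * mat_adjoint Z" and ?s = "singval_vec Z"
  have A: "?A \<in> hermitian_mats p"
    using Z carrier_matD[OF Z] by (auto simp: hermitian_mats_def adjoint_mult)
  define d where "d = eigval_vec ?A"
  have d: "dim_vec d = p" using eig_bases_nonempty(1)[OF A] by (simp add: d_def)
  then show s: "dim_vec ?s = p" by (simp add: singval_vec_def d_def)
  have s_eq: "?s $ i = sqrt (d $ i)" if "i < p" for i
    using that d by (simp add: singval_vec_def d_def)
  obtain P where P: "P \<in> unitary_mats p" and A_eq: "?A = P * Diag d * mat_adjoint P"
    using eig_bases_nonempty(2)[OF A] Z by (auto simp: eig_bases_def d_def)
  have c: "P \<in> carrier_mat p p" "(Diag d :: 'a mat) \<in> carrier_mat p p"
    using P d by (auto simp: unitary_carrier Diag_eq_Diag_pad)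
  define W where "W = mat_adjoint P * Z"
  have W: "W \<in> carrier_mat p q" using carrier_matD[OF c(1)] carrier_matD[OF Z] by (intro carrier_matI) (simp_all add: W_def)
  have Z_eq: "Z = P * W" using unitary_mult_cancel(1)[OF P Z] by (simp add: W_def)
  have "W * mat_adjoint W = mat_adjoint P * (?A * P)"
    using carrier_matD[OF Z] carrier_matD[OF c(1)] by (simp add: W_def adjoint_mult mult_mat_assoc)
  also have "\<dots> = mat_adjoint P * (P * (Diag d * (mat_adjoint P * P)))"
    using carrier_matD[OF c(1)] d by (simp add: A_eq mult_mat_assoc)
  also have "mat_adjoint P * P = 1\<^sub>m p" using P by (auto simp: unitary_mats_def)
  also have "mat_adjoint P * (P * (Diag d * 1\<^sub>m p)) = Diag d"
    unfolding right_mult_one_mat[OF c(2)] by (rule unitary_mult_cancel(2)[OF P c(2)])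
  finally have gram: "row W i \<bullet>c row W j = (if i = j then of_real (d $ i) else 0)"
    if "i < p" "j < p" for i j
    using that d gram_index[OF W that] by (auto simp: Diag_def mat_diag_def)
  have rW: "row W i \<in> carrier_vec q" if "i < p" for i using W that by auto
  have d_nonneg: "d $ i \<ge> 0" and d_zero: "d $ i = 0 \<Longrightarrow> row W i = 0\<^sub>v q" if i: "i < p" for i
  proof -
    obtain r where "r \<ge> 0" "row W i \<bullet>c row W i = of_real r" "r = 0 \<longrightarrow> row W i = 0\<^sub>v q"
      using inner_self_real[OF rW[OF i]] by blast
    moreover from this have "d $ i = r" using gram[OF i i] by simp
    ultimately show "d $ i \<ge> 0" "d $ i = 0 \<Longrightarrow> row W i = 0\<^sub>v q" by auto
  qed
  show "?s $ i \<ge> 0" if "i < p" for i using d_nonneg[OF that] s_eq[OF that] by simp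
  \<comment> \<open>the rows of \<open>V\<close> that \<open>W\<close> does not determine: beyond the first \<open>p\<close>, or where the singular value vanishes\<close>
  define T where "T = {i. i < q \<and> (i < p \<longrightarrow> d $ i = 0)}"
  define f where "f i = of_real (1 / ?s $ i) \<cdot>\<^sub>v row W i" for i
  have S: "i < p" "d $ i > 0" if "i \<in> {..<q} - T" for i
    using that d_nonneg[of i] by (auto simp: T_def)
  have orth: "f i \<bullet>c f j = (if i = j then 1 else 0)" if "i \<in> {..<q} - T" "j \<in> {..<q} - T" for i j
  proof -
    have ij: "i < p" "j < p" using S that by auto
    have "f i \<bullet>c f j = of_real (1 / ?s $ i) * (of_real (1 / ?s $ j) * (row W i \<bullet>c row W j))"
      using rW[OF ij(1)] rW[OF ij(2)] unfolding f_def conjugate_smult_vec conjugate_of_real by simp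
    also have "\<dots> = (if i = j then of_real (1 / ?s $ i * (1 / ?s $ i * d $ i)) else 0)"
      unfolding gram[OF ij] of_real_mult by simp
    also have "1 / ?s $ i * (1 / ?s $ i * d $ i) = 1"
      using S[OF that(1)] by (simp add: s_eq)
    finally show ?thesis by simp
  qed
  have "\<exists>V\<in>unitary_mats q. \<forall>i\<in>{..<q} - T. row V i = f i"
  proof (rule ex_unitary_extension)
    show "finite T" "T \<subseteq> {..<q}" by (auto simp: T_def)
    show "f i \<in> carrier_vec q" if "i \<in> {..<q} - T" for i
      using rW[OF S(1)[OF that]] by (simp add: f_def)
  qed (rule orth)
  then obtain V where V: "V \<in> unitary_mats q" "\<And>i. i \<in> {..<q} - T \<Longrightarrow> row V i = f i"
    by blast
  have cV: "V \<in> carrier_mat q q" using V(1) by (rule unitary_carrier)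
  have W_eq: "W = Diag_pad q ?s * V"
  proof (rule eq_matI)
    fix i j assume "i < dim_row (Diag_pad q ?s * V)" "j < dim_col (Diag_pad q ?s * V)"
    then have ij: "i < p" "j < q" using cV s by (auto simp: Diag_pad_def)
    have "W $$ (i, j) = of_real (?s $ i) * V $$ (i, j)"
    proof (cases "i \<in> T")
      case True
      then have "d $ i = 0" using ij by (simp add: T_def)
      then show ?thesis
        using arg_cong[OF d_zero[OF ij(1)], of "\<lambda>v. v $ j"] ij W by (simp add: s_eq)
    next
      case False
      then have "row V i = f i" "d $ i > 0" using V(2) S ij \<open>p \<le> q\<close> by auto
      moreover have "V $$ (i, j) = row V i $ j" using ij carrier_matD[OF cV] \<open>p \<le> q\<close> by simp
      ultimately have "V $$ (i, j) = of_real (1 / ?s $ i) * W $$ (i, j)"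
        using ij carrier_matD[OF W] by (simp add: f_def)
      then show ?thesis using \<open>d $ i > 0\<close> ij by (simp add: s_eq)
    qed
    then show "W $$ (i, j) = (Diag_pad q ?s * V) $$ (i, j)"
      using Diag_pad_mult_index[OF cV s \<open>p \<le> q\<close> ij] by simp
  qed (use W cV s in \<open>auto simp: Diag_pad_def\<close>)
  have "P * Diag_pad q ?s * mat_adjoint (mat_adjoint V) = P * W"
    using carrier_matD[OF c(1)] carrier_matD[OF cV] s by (simp add: W_eq mult_mat_assoc)
  then have "Z = P * Diag_pad q ?s * mat_adjoint (mat_adjoint V)" using Z_eq by simp
  then have "(P, mat_adjoint V) \<in> sing_bases Z"
    using Z P V(1) by (auto simp: sing_bases_def unitary_adjoint)
  then show "sing_bases Z \<noteq> {}" by blast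
qed

section \<open>Independence of the bases\<close>

text \<open>
  Two pairs of bases give the same matrix from \<open>D\<close> exactly if the change-of-basis matrices
  intertwine \<open>D\<close>. Independence of the bases is thus a statement about entries: whatever intertwines
  the diagonal of eigenvalues or singular values must intertwine the new diagonal.
\<close>

lemma intertwine_iff:
  fixes U V :: "'a mat"
  assumes U: "U \<in> unitary_mats p" "U' \<in> unitary_mats p"
    and V: "V \<in> unitary_mats q" "V' \<in> unitary_mats q"
    and D: "D \<in> carrier_mat p q"
  shows "U * D * mat_adjoint V = U' * D * mat_adjoint V' \<longleftrightarrow>
    (mat_adjoint U * U') * D = D * (mat_adjoint V * V')"
proof -
  have c: "U \<in> carrier_mat p p" "U' \<in> carrier_mat p p" "V \<in> carrier_mat q q" "V' \<in> carrier_mat q q"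
    using U V by (auto simp: unitary_carrier)
  note dims = c[THEN carrier_matD(1)] c[THEN carrier_matD(2)] carrier_matD[OF D]
  note assoc = mult_mat_assoc dims
  have V1: "mat_adjoint V * V = 1\<^sub>m q" "mat_adjoint V' * V' = 1\<^sub>m q" using V by (auto simp: unitary_mats_def)
  have V2: "V' * mat_adjoint V' = 1\<^sub>m q" using V by (auto simp: unitary_mats_def)
  show ?thesis
  proof
    assume eq: "U * D * mat_adjoint V = U' * D * mat_adjoint V'"
    have "(mat_adjoint U * U') * D = mat_adjoint U * (U' * D * mat_adjoint V') * V'"
      using c D V1 by (simp add: assoc)
    also have "\<dots> = mat_adjoint U * (U * (D * (mat_adjoint V * V')))"
      unfolding eq[symmetric] using c D by (simp add: assoc)
    also have "\<dots> = D * (mat_adjoint V * V')"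
      using c D by (intro unitary_mult_cancel(2)[OF U(1)]) auto
    finally show "(mat_adjoint U * U') * D = D * (mat_adjoint V * V')" .
  next
    assume eq: "(mat_adjoint U * U') * D = D * (mat_adjoint V * V')"
    have "U' * D * mat_adjoint V' = U * (mat_adjoint U * (U' * D)) * mat_adjoint V'"
      using c D unitary_mult_cancel(1)[OF U(1), of "U' * D" q] by simp
    also have "mat_adjoint U * (U' * D) = D * (mat_adjoint V * V')"
      using eq c D by (simp add: assoc)
    also have "U * (D * (mat_adjoint V * V')) * mat_adjoint V' = U * D * mat_adjoint V"
      using c D V2 by (simp add: assoc)
    finally show "U * D * mat_adjoint V = U' * D * mat_adjoint V'" ..
  qed
qed

lemma intertwine_Diag_pad_iff:
  fixes A B :: "'a mat"
  assumes "A \<in> carrier_mat p p" "B \<in> carrier_mat q q" "dim_vec x = p" "p \<le> q"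
  shows "A * Diag_pad q x = Diag_pad q x * B \<longleftrightarrow>
    (\<forall>i<p. \<forall>j<q. of_real (x $ i) * B $$ (i, j) = (if j < p then A $$ (i, j) * of_real (x $ j) else 0))"
    (is "?L = ?R \<longleftrightarrow> _")
proof -
  have c: "?L \<in> carrier_mat p q" "?R \<in> carrier_mat p q" using assms by auto
  have "?L = ?R \<longleftrightarrow> (\<forall>i<p. \<forall>j<q. ?L $$ (i, j) = ?R $$ (i, j))"
    using c by (metis (no_types) carrier_matD eq_matI)
  then show ?thesis
    using assms by (simp add: mult_Diag_pad_index[of _ p p] Diag_pad_mult_index[of _ q q _ p] eq_commute del: index_mult_mat(1))
qed

text \<open>
  The matrix \<open>P\<^sup>* P'\<close> commutes with the diagonal of eigenvalues, so its \<open>(i, j)\<close> entry vanishes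
  unless the \<open>i\<close>-th and \<open>j\<close>-th eigenvalues agree. Then it commutes with every diagonal matrix that
  is constant on equal eigenvalues.
\<close>

lemma eig_bases_independent:
  fixes A :: "'a mat"
  assumes A: "A \<in> hermitian_mats p" and P: "P \<in> eig_bases A" "P' \<in> eig_bases A"
    and y: "dim_vec y = p"
    and eq: "\<And>i j. i < p \<Longrightarrow> j < p \<Longrightarrow> eigval_vec A $ i = eigval_vec A $ j \<Longrightarrow> y $ i = y $ j"
  shows "P * Diag y * mat_adjoint P = P' * Diag y * mat_adjoint P'"
proof -
  let ?x = "eigval_vec A"
  have x: "dim_vec ?x = p" using eig_bases_nonempty(1)[OF A] .
  have "dim_row A = p" using A by (auto simp: hermitian_mats_def)
  then have U: "P \<in> unitary_mats p" "P' \<in> unitary_mats p"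
    and "P * Diag_pad p ?x * mat_adjoint P = P' * Diag_pad p ?x * mat_adjoint P'"
    using P x by (auto simp: eig_bases_def Diag_eq_Diag_pad)
  then have "(mat_adjoint P * P') * Diag_pad p ?x = Diag_pad p ?x * (mat_adjoint P * P')"
    using intertwine_iff[OF U U] x by auto
  moreover have c: "mat_adjoint P * P' \<in> carrier_mat p p"
    using unitary_mult[OF unitary_adjoint[OF U(1)] U(2)] by (rule unitary_carrier)
  ultimately have comm: "of_real (?x $ i) * (mat_adjoint P * P') $$ (i, j) = (mat_adjoint P * P') $$ (i, j) * of_real (?x $ j)"
    if "i < p" "j < p" for i j
    using that intertwine_Diag_pad_iff[OF c c x] by auto
  have "of_real (y $ i) * (mat_adjoint P * P') $$ (i, j) = (mat_adjoint P * P') $$ (i, j) * of_real (y $ j)"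
    if "i < p" "j < p" for i j
    using comm[OF that] eq[OF that] by (cases "?x $ i = ?x $ j") (auto simp: mult.commute)
  then have "(mat_adjoint P * P') * Diag_pad p y = Diag_pad p y * (mat_adjoint P * P')"
    using intertwine_Diag_pad_iff[OF c c y] by auto
  then show ?thesis
    using intertwine_iff[OF U U, of "Diag_pad p y"] y by (auto simp: Diag_eq_Diag_pad)
qed

text \<open>
  With \<open>A = U\<^sup>* U'\<close> and \<open>B = V\<^sup>* V'\<close>, intertwining \<open>[Diag(\<sigma>) 0]\<close> and its adjoint gives
  \<open>\<sigma>\<^sub>i B\<^sub>i\<^sub>j = A\<^sub>i\<^sub>j \<sigma>\<^sub>j\<close> and \<open>\<sigma>\<^sub>j B\<^sub>i\<^sub>j = A\<^sub>i\<^sub>j \<sigma>\<^sub>i\<close> for \<open>i, j < p\<close>, and \<open>\<sigma>\<^sub>i B\<^sub>i\<^sub>j = 0\<close> for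
  \<open>j \<ge> p\<close>. Since \<open>\<sigma> \<ge> 0\<close>, either the entries \<open>A\<^sub>i\<^sub>j\<close> and \<open>B\<^sub>i\<^sub>j\<close> vanish, or they coincide and
  \<open>\<sigma>\<^sub>i = \<sigma>\<^sub>j\<close>, or \<open>\<sigma>\<^sub>i = \<sigma>\<^sub>j = 0\<close>. In the last case \<open>A\<close> and \<open>B\<close> are unrelated, which is why \<open>y\<close>
  has to vanish where \<open>\<sigma>\<close> does.
\<close>

lemma sing_bases_independent:
  fixes Z :: "'a mat"
  assumes Z: "Z \<in> carrier_mat p q" and "p \<le> q" and UV: "(U, V) \<in> sing_bases Z" "(U', V') \<in> sing_bases Z"
    and y: "dim_vec y = p"
    and eq: "\<And>i j. i < p \<Longrightarrow> j < p \<Longrightarrow> singval_vec Z $ i = singval_vec Z $ j \<Longrightarrow> y $ i = y $ j"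
    and zero: "\<And>i. i < p \<Longrightarrow> singval_vec Z $ i = 0 \<Longrightarrow> y $ i = 0"
  shows "U * Diag_pad q y * mat_adjoint V = U' * Diag_pad q y * mat_adjoint V'"
proof -
  let ?x = "singval_vec Z"
  note x = sing_bases_nonempty(1,2)[OF Z \<open>p \<le> q\<close>]
  have U: "U \<in> unitary_mats p" "U' \<in> unitary_mats p" and V: "V \<in> unitary_mats q" "V' \<in> unitary_mats q"
    and Z_eq: "U * Diag_pad q ?x * mat_adjoint V = U' * Diag_pad q ?x * mat_adjoint V'"
    using UV Z by (auto simp: sing_bases_def)
  let ?A = "mat_adjoint U * U'" and ?B = "mat_adjoint V * V'"
  have cU: "U \<in> carrier_mat p p" "U' \<in> carrier_mat p p" and cV: "V \<in> carrier_mat q q" "V' \<in> carrier_mat q q"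
    using U V by (auto simp: unitary_carrier)
  then have c: "?A \<in> carrier_mat p p" "?B \<in> carrier_mat q q"
    "mat_adjoint U' * U \<in> carrier_mat p p" "mat_adjoint V' * V \<in> carrier_mat q q" by auto
  have "?A * Diag_pad q ?x = Diag_pad q ?x * ?B"
    using intertwine_iff[OF U V, of "Diag_pad q ?x"] Z_eq x(1) by (metis Diag_pad_carrier)
  then have 1: "of_real (?x $ i) * ?B $$ (i, j) = (if j < p then ?A $$ (i, j) * of_real (?x $ j) else 0)"
    if "i < p" "j < q" for i j
    using that intertwine_Diag_pad_iff[OF c(1,2) x(1) \<open>p \<le> q\<close>] by auto
  \<comment> \<open>exchanging the two pairs of bases amounts to taking the adjoint of the intertwining relation\<close>
  have "(mat_adjoint U' * U) * Diag_pad q ?x = Diag_pad q ?x * (mat_adjoint V' * V)"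
    using intertwine_iff[OF U(2,1) V(2,1), of "Diag_pad q ?x"] Z_eq x(1) by (metis Diag_pad_carrier)
  then have 2: "of_real (?x $ j) * (mat_adjoint V' * V) $$ (j, i) = (mat_adjoint U' * U) $$ (j, i) * of_real (?x $ i)"
    if "i < p" "j < p" for i j
    using that \<open>p \<le> q\<close> intertwine_Diag_pad_iff[OF c(3,4) x(1) \<open>p \<le> q\<close>] by auto
  have adj: "mat_adjoint U' * U = mat_adjoint ?A" "mat_adjoint V' * V = mat_adjoint ?B"
    using cU[THEN carrier_matD(1)] cU[THEN carrier_matD(2)] cV[THEN carrier_matD(1)] cV[THEN carrier_matD(2)]
    by (simp_all add: adjoint_mult)
  have 2: "of_real (?x $ j) * ?B $$ (i, j) = ?A $$ (i, j) * of_real (?x $ i)"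
    if ij: "i < p" "j < p" for i j
  proof -
    have "of_real (?x $ j) * conjugate (?B $$ (i, j)) = conjugate (?A $$ (i, j)) * of_real (?x $ i)"
      using 2[OF ij] ij c \<open>p \<le> q\<close> unfolding adj by (simp del: index_mult_mat)
    then have "conjugate (of_real (?x $ j) * conjugate (?B $$ (i, j)))
        = conjugate (conjugate (?A $$ (i, j)) * of_real (?x $ i))" by simp
    then show ?thesis by (simp add: conjugate_dist_mul)
  qed
  have "of_real (y $ i) * ?B $$ (i, j) = (if j < p then ?A $$ (i, j) * of_real (y $ j) else 0)"
    if i: "i < p" and j: "j < q" for i j
  proof (cases "j < p")
    case True
    let ?a = "?A $$ (i, j)" and ?b = "?B $$ (i, j)"
    have b: "of_real (?x $ i) * ?b = ?a * of_real (?x $ j)" "of_real (?x $ j) * ?b = ?a * of_real (?x $ i)"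
      using 1[OF i j] 2[OF i True] True by auto
    consider "?x $ i = ?x $ j" "?x $ i = 0" | "?x $ i = ?x $ j" "?x $ i \<noteq> 0" | "?x $ i \<noteq> ?x $ j" by blast
    then have "of_real (y $ i) * ?b = ?a * of_real (y $ j)"
    proof cases
      case 1
      then show ?thesis using zero i True by simp
    next
      case 2
      then have "?a = ?b" using b(1) by (simp add: mult.commute)
      then show ?thesis using 2 eq[OF i True] by simp
    next
      case 3
      have "(of_real (?x $ i) + of_real (?x $ j)) * (?b - ?a) = 0"
        using b by (simp add: algebra_simps)
      moreover have "?x $ i + ?x $ j \<noteq> 0" using 3 x(2)[OF i] x(2)[OF True] by auto
      then have "of_real (?x $ i) + of_real (?x $ j) \<noteq> (0 :: 'a)"
        by (metis of_real_add of_real_eq_0_iff)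
      ultimately have ab: "?b = ?a" by simp
      then have "(of_real (?x $ i) - of_real (?x $ j)) * ?a = 0"
        using b by (simp add: algebra_simps)
      then show ?thesis using 3 ab by simp
    qed
    then show ?thesis using True by simp
  next
    case False
    then show ?thesis using 1[OF i j] zero[OF i] by auto
  qed
  then have "?A * Diag_pad q y = Diag_pad q y * ?B"
    using intertwine_Diag_pad_iff[OF c(1,2) y \<open>p \<le> q\<close>] by auto
  then show ?thesis
    using intertwine_iff[OF U V, of "Diag_pad q y"] y by auto
qed

end

section \<open>Joined vectors and signed permutations\<close>

lemma vec_join_index:
  assumes "\<And>j. j \<in> {1..s} \<Longrightarrow> dim_vec (f j) = m j" "k \<in> {1..s}" "i < m k"
  shows "vec_join s f $ (sum m {1..<k} + i) = f k $ i"
proof -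
  define L where "L s = concat (map (\<lambda>k. list_of_vec (f k)) [1..<Suc s])" for s
  have L_Suc: "L (Suc t) = L t @ list_of_vec (f (Suc t))" for t
    by (simp add: L_def upt_Suc_append)
  have len: "length (L t) = sum m {1..<Suc t}" if "t \<le> s" for t
    using that
  proof (induction t)
    case (Suc t)
    then show ?case using assms(1)[of "Suc t"] by (simp add: L_Suc)
  qed (simp add: L_def)
  have "L t ! (sum m {1..<k} + i) = f k $ i" if "k \<le> t" "t \<le> s" for t
    using that
  proof (induction t)
    case 0
    then show ?case using assms(2) by simp
  next
    case (Suc t)
    show ?case
    proof (cases "k = Suc t")
      case True
      then show ?thesis
        using assms Suc.prems len[of t] by (simp add: L_Suc nth_append list_of_vec_index)
    next
      case False
      then have "k \<le> t" using Suc.prems by simp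
      have "sum m {1..<k} + i < sum m {1..<Suc k}" using assms by simp
      also have "\<dots> \<le> sum m {1..<Suc t}" using \<open>k \<le> t\<close> by (intro sum_mono2) auto
      finally show ?thesis
        using Suc \<open>k \<le> t\<close> len[of t] by (simp add: L_Suc nth_append)
    qed
  qed
  from this[of s] show ?thesis using assms by (simp add: vec_join_def vec_of_list_index L_def)
qed

lemma vec_block_vec_join:
  assumes "\<And>j. j \<in> {1..s} \<Longrightarrow> dim_vec (f j) = m j" "k \<in> {1..s}"
  shows "vec_block m k (vec_join s f) = f k"
  using assms vec_join_index[OF assms] by (intro eq_vecI) (simp_all add: vec_block_def)

lemma vec_join_cong: "(\<And>k. k \<in> {1..s} \<Longrightarrow> f k = h k) \<Longrightarrow> vec_join s f = vec_join s h"
  unfolding vec_join_def by (intro arg_cong[of _ _ vec_of_list] arg_cong[of _ _ concat] map_cong) auto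

definition monomial_mat :: "nat \<Rightarrow> (nat \<Rightarrow> nat) \<Rightarrow> (nat \<Rightarrow> real) \<Rightarrow> real mat" where
  "monomial_mat p \<pi> \<epsilon> = mat p p (\<lambda>(i, j). if j = \<pi> i then \<epsilon> i else 0)"

lemma monomial_mat_mult_vec:
  assumes "\<pi> permutes {..<p}" "dim_vec v = p"
  shows "monomial_mat p \<pi> \<epsilon> *\<^sub>v v = vec p (\<lambda>i. \<epsilon> i * v $ \<pi> i)"
proof (rule eq_vecI)
  fix i assume "i < dim_vec (vec p (\<lambda>i. \<epsilon> i * v $ \<pi> i))"
  then have i: "i < p" "\<pi> i < p" using permutes_in_image[OF assms(1)] by auto
  then have "(monomial_mat p \<pi> \<epsilon> *\<^sub>v v) $ i = (\<Sum>j\<in>{0..<p}. (if j = \<pi> i then \<epsilon> i else 0) * v $ j)"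
    using assms(2) by (simp add: monomial_mat_def scalar_prod_def)
  also have "\<dots> = (\<Sum>j\<in>{0..<p}. if j = \<pi> i then \<epsilon> i * v $ \<pi> i else 0)"
    by (intro sum.cong) auto
  also have "\<dots> = \<epsilon> i * v $ \<pi> i" using i by (simp add: sum.delta)
  finally show "(monomial_mat p \<pi> \<epsilon> *\<^sub>v v) $ i = vec p (\<lambda>i. \<epsilon> i * v $ \<pi> i) $ i" using i by simp
qed (simp add: monomial_mat_def)

lemma monomial_mat_signed_perm:
  assumes pi: "\<pi> permutes {..<p}" and eps: "\<And>i. \<epsilon> i \<in> {-1, 1}"
  shows "monomial_mat p \<pi> \<epsilon> \<in> signed_perm_mats p"
proof -
  have less: "\<pi> i < p \<longleftrightarrow> i < p" for i using permutes_in_image[OF pi, of i] by simp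
  have col: "\<exists>!i. i < p \<and> j = \<pi> i" if "j < p" for j
    using that less permutes_inverses[OF pi] by metis
  let ?Q = "monomial_mat p \<pi> \<epsilon>"
  have index: "?Q $$ (i, j) = (if j = \<pi> i then \<epsilon> i else 0)" if "i < p" "j < p" for i j
    using that by (simp add: monomial_mat_def)
  then have nz: "?Q $$ (i, j) \<noteq> 0 \<longleftrightarrow> j = \<pi> i" if "i < p" "j < p" for i j
    using that eps[of i] by auto
  have "\<exists>!j. j < p \<and> ?Q $$ (i, j) \<noteq> 0" if "i < p" for i
    using nz[OF that] less[of i] that by metis
  moreover have "\<exists>!i. i < p \<and> ?Q $$ (i, j) \<noteq> 0" if "j < p" for j
    using nz[OF _ that] col[OF that] by metis
  moreover have "?Q $$ (i, j) \<in> {-1, 0, 1}" if "i < p" "j < p" for i j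
    using index[OF that] eps[of i] by auto
  moreover have "?Q \<in> carrier_mat p p" by (simp add: monomial_mat_def)
  ultimately show ?thesis by (simp add: signed_perm_mats_def)
qed

lemma monomial_mat_perm:
  "\<pi> permutes {..<p} \<Longrightarrow> monomial_mat p \<pi> (\<lambda>_. 1) \<in> perm_mats p"
  using monomial_mat_signed_perm[of \<pi> p "\<lambda>_. 1"] by (auto simp: perm_mats_def monomial_mat_def)

text \<open>
  Act by \<open>Q\<close> on block \<open>k\<close> and trivially on the others. If this fixes the joined vector, mixed
  symmetry says that it fixes the image under \<open>g\<close>.
\<close>

lemma mixed_symmetric_block:
  assumes g: "mixed_symmetric_on s s0 m g S" and x: "vec_join s f \<in> S"
    and f: "\<And>j. j \<in> {1..s} \<Longrightarrow> dim_vec (f j) = m j" and k: "k \<in> {1..s}"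
    and Q: "Q \<in> (if k \<le> s0 then perm_mats (m k) else signed_perm_mats (m k))" and fixed: "Q *\<^sub>v f k = f k"
  shows "Q *\<^sub>v vec_block m k (g (vec_join s f)) = vec_block m k (g (vec_join s f))"
proof -
  let ?x = "vec_join s f"
  define R where "R j = (if j = k then Q else monomial_mat (m j) id (\<lambda>_. 1))" for j
  have Rm: "R \<in> mixed_perms s s0 m"
    using Q monomial_mat_perm[OF permutes_id] monomial_mat_signed_perm[OF permutes_id, of "\<lambda>_. 1"]
    by (auto simp: mixed_perms_def R_def)
  have dim: "dim_row (R j) = m j" if "j \<in> {1..s}" for j
    using Q by (auto simp: R_def monomial_mat_def perm_mats_def signed_perm_mats_def split: if_splits)
  have "vec_join s (\<lambda>j. R j *\<^sub>v vec_block m j ?x) = ?x"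
  proof (rule vec_join_cong)
    fix j assume j: "j \<in> {1..s}"
    have "R j *\<^sub>v f j = f j"
    proof (cases "j = k")
      case False
      then show ?thesis
        using f[OF j] monomial_mat_mult_vec[OF permutes_id f[OF j], of "\<lambda>_. 1"]
        by (auto simp: R_def)
    qed (use fixed in \<open>simp add: R_def\<close>)
    moreover have "vec_block m j ?x = f j" using f j by (rule vec_block_vec_join)
    ultimately show "R j *\<^sub>v vec_block m j ?x = f j" by simp
  qed
  moreover have "g (vec_join s (\<lambda>j. R j *\<^sub>v vec_block m j ?x)) = vec_join s (\<lambda>j. R j *\<^sub>v vec_block m j (g ?x))"
    using g x Rm unfolding mixed_symmetric_on_def by blast
  ultimately have eq: "g ?x = vec_join s (\<lambda>j. R j *\<^sub>v vec_block m j (g ?x))" by (simp only:)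
  have "vec_block m k (g ?x) = vec_block m k (vec_join s (\<lambda>j. R j *\<^sub>v vec_block m j (g ?x)))"
    by (rule arg_cong[OF eq])
  also have "\<dots> = R k *\<^sub>v vec_block m k (g ?x)"
    using dim k by (intro vec_block_vec_join) auto
  finally show ?thesis by (simp add: R_def)
qed

text \<open>
  Transposing two equal entries of block \<open>k\<close> is such a symmetry.
\<close>

lemma mixed_symmetric_block_eq:
  assumes g: "mixed_symmetric_on s s0 m g S" and x: "vec_join s f \<in> S"
    and f: "\<And>j. j \<in> {1..s} \<Longrightarrow> dim_vec (f j) = m j" and k: "k \<in> {1..s}"
    and ij: "i < m k" "j < m k" and eq: "f k $ i = f k $ j"
  shows "vec_block m k (g (vec_join s f)) $ i = vec_block m k (g (vec_join s f)) $ j"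
proof -
  let ?\<tau> = "transpose i j" and ?y = "vec_block m k (g (vec_join s f))"
  let ?Q = "monomial_mat (m k) ?\<tau> (\<lambda>_. 1)"
  have perm: "?\<tau> permutes {..<m k}" using ij by (intro permutes_swap_id) auto
  have y: "dim_vec ?y = m k" by (simp add: vec_block_def)
  have "?Q *\<^sub>v f k = f k"
    unfolding monomial_mat_mult_vec[OF perm f[OF k]]
    using f[OF k] eq by (intro eq_vecI) (auto simp: Transposition.transpose_def)
  moreover have "?Q \<in> (if k \<le> s0 then perm_mats (m k) else signed_perm_mats (m k))"
    using monomial_mat_perm[OF perm] by (auto simp: perm_mats_def)
  ultimately have "?Q *\<^sub>v ?y = ?y" using mixed_symmetric_block[where Q = ?Q, OF g x f k] by blast
  from arg_cong[OF this, of "\<lambda>v. v $ i"] show ?thesis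
    using ij by (simp add: monomial_mat_mult_vec[OF perm y])
qed

text \<open>
  So is changing the sign of a zero entry, in the blocks where signed permutations act. A number
  equal to its negative is zero.
\<close>

lemma mixed_symmetric_block_zero:
  assumes g: "mixed_symmetric_on s s0 m g S" and x: "vec_join s f \<in> S"
    and f: "\<And>j. j \<in> {1..s} \<Longrightarrow> dim_vec (f j) = m j" and k: "k \<in> {1..s}" "\<not> k \<le> s0"
    and i: "i < m k" and eq: "f k $ i = 0"
  shows "vec_block m k (g (vec_join s f)) $ i = 0"
proof -
  let ?\<epsilon> = "\<lambda>l. if l = i then - 1 else 1 :: real" and ?y = "vec_block m k (g (vec_join s f))"
  let ?Q = "monomial_mat (m k) id ?\<epsilon>"
  have y: "dim_vec ?y = m k" by (simp add: vec_block_def)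
  have "?Q *\<^sub>v f k = f k"
    unfolding monomial_mat_mult_vec[OF permutes_id f[OF k(1)]]
    using f[OF k(1)] eq by (intro eq_vecI) auto
  moreover have "?Q \<in> (if k \<le> s0 then perm_mats (m k) else signed_perm_mats (m k))"
    using monomial_mat_signed_perm[OF permutes_id, of ?\<epsilon> "m k"] k(2) by auto
  ultimately have "?Q *\<^sub>v ?y = ?y" using mixed_symmetric_block[where Q = ?Q, OF g x f k(1)] by blast
  from arg_cong[OF this, of "\<lambda>v. v $ i"] show ?thesis
    using i by (simp add: monomial_mat_mult_vec[OF permutes_id y])
qed

section \<open>Spectral operators\<close>

text \<open>
  The eigenvalue and singular value blocks of \<open>\<kappa>(X)\<close> are exactly the blocks \<open>f\<close> to which mixed
  symmetry applies; it supplies the coincidences of entries of \<open>g(\<kappa>(X))\<close> that independence of the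
  bases requires. Existence of the decompositions provides at least one value.
\<close>

theorem (in spectral_field) spectral_operator_well_defined:
  fixes X :: "nat \<Rightarrow> 'a mat"
  assumes mn: "\<forall>k\<in>{s0+1..s}. m k \<le> n k" and X: "X \<in> mat_space s s0 m n"
    and g: "mixed_symmetric_on s s0 m g S" and S: "kappa s s0 X \<in> S" and "s0 \<le> s"
  shows "\<exists>Y\<in>mat_space s s0 m n. spectral_value s s0 m n g X ` spectral_choices s s0 X = {Y}"
proof -
  define f where "f k = (if k \<le> s0 then eigval_vec (X k) else singval_vec (X k))" for k
  have kappa: "kappa s s0 X = vec_join s f" by (simp add: kappa_def f_def[abs_def])
  have f_eig: "f k = eigval_vec (X k)" if "k \<in> {1..s0}" for k using that by (simp add: f_def)
  have f_sing: "f k = singval_vec (X k)" if "k \<in> {s0+1..s}" for k using that by (simp add: f_def)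
  define y where "y k = vec_block m k (g (kappa s s0 X))" for k
  have y: "dim_vec (y k) = m k" for k by (simp add: y_def vec_block_def)
  have herm: "X k \<in> hermitian_mats (m k)" if "k \<in> {1..s0}" for k
    using X that \<open>s0 \<le> s\<close> by (auto simp: mat_space_def PiE_iff dest!: bspec[of _ _ k])
  have rect: "X k \<in> carrier_mat (m k) (n k)" "m k \<le> n k" if "k \<in> {s0+1..s}" for k
    using X mn that by (auto simp: mat_space_def PiE_iff dest!: bspec[of _ _ k])
  have f: "dim_vec (f k) = m k" if "k \<in> {1..s}" for k
    using that eig_bases_nonempty(1)[OF herm, of k] sing_bases_nonempty(1)[OF rect, of k] by (auto simp: f_def)
  note blocks = mixed_symmetric_block_eq[OF g S[unfolded kappa] f] mixed_symmetric_block_zero[OF g S[unfolded kappa] f]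
  have indep_eig: "P * Diag (y k) * mat_adjoint P = P' * Diag (y k) * mat_adjoint P'"
    if "k \<in> {1..s0}" "P \<in> eig_bases (X k)" "P' \<in> eig_bases (X k)" for k P P'
  proof (rule eig_bases_independent[OF herm[OF that(1)] that(2,3) y])
    fix i j assume "i < m k" "j < m k" "eigval_vec (X k) $ i = eigval_vec (X k) $ j"
    then show "y k $ i = y k $ j"
      using blocks(1)[of k i j] that(1) \<open>s0 \<le> s\<close> by (simp add: y_def kappa f_eig)
  qed
  have indep_sing: "U * Diag_pad (n k) (y k) * mat_adjoint V = U' * Diag_pad (n k) (y k) * mat_adjoint V'"
    if "k \<in> {s0+1..s}" "(U, V) \<in> sing_bases (X k)" "(U', V') \<in> sing_bases (X k)" for k U V U' V'
  proof (rule sing_bases_independent[OF rect[OF that(1)] that(2,3) y])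
    fix i j assume "i < m k" "j < m k" "singval_vec (X k) $ i = singval_vec (X k) $ j"
    then show "y k $ i = y k $ j"
      using blocks(1)[of k i j] that(1) by (simp add: y_def kappa f_sing)
  next
    fix i assume "i < m k" "singval_vec (X k) $ i = 0"
    then show "y k $ i = 0"
      using blocks(2)[of k i] that(1) by (simp add: y_def kappa f_sing)
  qed
  have value_eq: "spectral_value s s0 m n g X (P, U, V) = (\<lambda>k\<in>{1..s}.
     if k \<le> s0 then P k * Diag (y k) * mat_adjoint (P k) else U k * Diag_pad (n k) (y k) * mat_adjoint (V k))" for P U V
    unfolding spectral_value_def y_def by simp
  have "\<forall>k\<in>{1..s0}. \<exists>P. P \<in> eig_bases (X k)"
    using eig_bases_nonempty(2)[OF herm] by blast
  then obtain P where P: "\<And>k. k \<in> {1..s0} \<Longrightarrow> P k \<in> eig_bases (X k)" by metis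
  have "\<forall>k\<in>{s0+1..s}. \<exists>UV. UV \<in> sing_bases (X k)"
    using sing_bases_nonempty(3)[OF rect] by blast
  then obtain UV where UV: "\<And>k. k \<in> {s0+1..s} \<Longrightarrow> UV k \<in> sing_bases (X k)" by metis
  define c where "c = (P, \<lambda>k. fst (UV k), \<lambda>k. snd (UV k))"
  have c: "c \<in> spectral_choices s s0 X" using P UV by (auto simp: c_def spectral_choices_def)
  let ?Y = "spectral_value s s0 m n g X c"
  have Y: "?Y \<in> mat_space s s0 m n"
  proof -
    have "P k * Diag (y k) * mat_adjoint (P k) \<in> hermitian_mats (m k)" if "k \<in> {1..s0}" for k
    proof (rule hermitian_congruence[OF Diag_hermitian[OF y]])
      have "dim_row (X k) = m k" using herm[OF that] by (auto simp: hermitian_mats_def)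
      then show "P k \<in> carrier_mat (m k) (m k)"
        using P[OF that] by (auto simp: eig_bases_def intro: unitary_carrier)
    qed
    moreover have "fst (UV k) * Diag_pad (n k) (y k) * mat_adjoint (snd (UV k)) \<in> carrier_mat (m k) (n k)"
      if "k \<in> {s0+1..s}" for k
    proof -
      have "fst (UV k) \<in> carrier_mat (m k) (m k)" "snd (UV k) \<in> carrier_mat (n k) (n k)"
        using UV[OF that] rect(1)[OF that] by (auto simp: sing_bases_def intro: unitary_carrier)
      then show ?thesis by (intro carrier_matI) auto
    qed
    ultimately show ?thesis unfolding c_def value_eq mat_space_def by (auto simp: PiE_iff)
  qed
  have const: "spectral_value s s0 m n g X c' = ?Y" if "c' \<in> spectral_choices s s0 X" for c'
  proof -
    obtain P' U' V' where c': "c' = (P', U', V')" by (cases c')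
    show ?thesis
      unfolding c' c_def value_eq
    proof (rule restrict_ext)
      fix k assume k: "k \<in> {1..s}"
      show "(if k \<le> s0 then P' k * Diag (y k) * mat_adjoint (P' k) else U' k * Diag_pad (n k) (y k) * mat_adjoint (V' k))
        = (if k \<le> s0 then P k * Diag (y k) * mat_adjoint (P k)
           else fst (UV k) * Diag_pad (n k) (y k) * mat_adjoint (snd (UV k)))"
      proof (cases "k \<le> s0")
        case True
        then have k0: "k \<in> {1..s0}" using k by simp
        then have "P' k \<in> eig_bases (X k)" using that by (simp add: c' spectral_choices_def)
        then show ?thesis unfolding if_P[OF True] by (rule indep_eig[OF k0 _ P[OF k0]])
      next
        case False
        then have k1: "k \<in> {s0+1..s}" using k by simp
        then have "(U' k, V' k) \<in> sing_bases (X k)" using that by (simp add: c' spectral_choices_def)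
        then show ?thesis
          unfolding if_not_P[OF False] using UV[OF k1] by (intro indep_sing[OF k1]) simp_all
      qed
    qed
  qed
  have "spectral_value s s0 m n g X ` spectral_choices s s0 X = (\<lambda>_. ?Y) ` spectral_choices s s0 X"
    using const by (rule image_cong[OF refl])
  also have "\<dots> = {?Y}" using c by (rule image_constant)
  finally show ?thesis using Y by (rule bexI)
qed

theorem theorem2p1:
  fixes s s0 :: nat and m n :: "nat \<Rightarrow> nat" and g :: "real vec \<Rightarrow> real vec"
  assumes "s \<ge> 1" and "s0 \<le> s"
    and "\<forall>k\<in>{1..s}. m k > 0"
    and "\<forall>k\<in>{s0+1..s}. n k > 0 \<and> m k \<le> n k"
    and "g \<in> carrier_vec (sum m {1..s0} + sum m {s0+1..s})
             \<rightarrow> carrier_vec (sum m {1..s0} + sum m {s0+1..s})"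
  shows "(\<forall>N :: (nat \<Rightarrow> real mat) set.
            N \<noteq> {} \<and> N \<subseteq> mat_space s s0 m n \<and> mixed_symmetric_on s s0 m g (kappa s s0 ` N) \<longrightarrow>
            (\<forall>X\<in>N. \<exists>Y\<in>mat_space s s0 m n.
               spectral_value s s0 m n g X ` spectral_choices s s0 X = {Y}))
       \<and> (\<forall>N :: (nat \<Rightarrow> complex mat) set.
            N \<noteq> {} \<and> N \<subseteq> mat_space s s0 m n \<and> mixed_symmetric_on s s0 m g (kappa s s0 ` N) \<longrightarrow>
            (\<forall>X\<in>N. \<exists>Y\<in>mat_space s s0 m n.
               spectral_value s s0 m n g X ` spectral_choices s s0 X = {Y}))"
proof -
  have mn: "\<forall>k\<in>{s0+1..s}. m k \<le> n k" using assms(4) by blast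
  have "\<exists>Y\<in>mat_space s s0 m n. spectral_value s s0 m n g X ` spectral_choices s s0 X = {Y}"
    if "N \<subseteq> mat_space s s0 m n" "mixed_symmetric_on s s0 m g (kappa s s0 ` N)" "X \<in> N"
    for N :: "(nat \<Rightarrow> real mat) set" and X
    using that assms(2) mn
    by (intro real_field.spectral_operator_well_defined[where S = "kappa s s0 ` N"]) auto
  moreover have "\<exists>Y\<in>mat_space s s0 m n. spectral_value s s0 m n g X ` spectral_choices s s0 X = {Y}"
    if "N \<subseteq> mat_space s s0 m n" "mixed_symmetric_on s s0 m g (kappa s s0 ` N)" "X \<in> N"
    for N :: "(nat \<Rightarrow> complex mat) set" and X
    using that assms(2) mn
    by (intro complex_field.spectral_operator_well_defined[where S = "kappa s s0 ` N"]) auto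
  ultimately show ?thesis by blast
qed

end
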